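(* Let $(M,F)$ be a strongly pseudoconvex complex Finsler manifold. Let $R_{\alpha\bar\beta\mu\bar\nu}$, $K_\nabla(H)$, $K_\nabla(v)$ denote the holomorphic sectional curvature tensor, the horizontal holomorphic flag curvature and the holomorphic sectional curvature of the canonical connection $\nabla$, and let $\Omega_{\alpha\bar\beta;\mu\bar\nu}$, $K_D(H)$, $K_D(v)$ denote the corresponding objects of the Chern-Finsler connection $D$. Then: (1) The following are equivalent: (i) $R_{\alpha\bar\beta\mu\bar\nu}=\Omega_{\alpha\bar\beta;\mu\bar\nu}$ on $\tilde M$ for all indices; (ii) $K_\nabla(H)=K_D(H)$ for all $v\in\tilde M$ and all nonzero horizontal vectors $H\in\mathcal H_v$; (iii) $F$ is a Kähler-Finsler metric. (2) $K_\nabla(v)=K_D(v)$ for all $v\in\tilde M$ if and only if $F$ is a weakly Kähler-Finsler metric.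
   Context: Basic notation. $M$ is a complex manifold with $n=\dim_{\mathbb C}M\ge 2$. Local holomorphic coordinates $z^1,\dots,z^n$ on $M$ induce coordinates $(z,v)$ on the holomorphic tangent bundle $T^{1,0}M$ via $v=v^\alpha\partial/\partial z^\alpha$; $\tilde M=T^{1,0}M\setminus\{0\}$ is the complement of the zero section. Greek indices run from $1$ to $n$, repeated indices are summed, and barred indices refer to conjugate variables/objects. A complex Finsler metric is a continuous $F:T^{1,0}M\to[0,\infty)$ with $G=F^2$ smooth on $\tilde M$, $F>0$ on $\tilde M$, and $F(z,\zeta v)=|\zeta|F(z,v)$ for $\zeta\in\mathbb C$. Put $G_\alpha=\partial G/\partial v^\alpha$, $G_{\alpha\bar\beta}=\partial^2G/\partial v^\alpha\partial\bar v^\beta$, $G_{\alpha\bar\beta\sigma}=\partial G_{\alpha\bar\beta}/\partial v^\sigma$. $F$ is strongly pseudoconvex if $(G_{\alpha\bar\beta})$ is positive definite on $\tilde M$; $(G^{\bar\beta\alpha})$ is the inverse matrix. Put $\dot\partial_\alpha=\partial/\partial v^\alpha$, $\Gamma^\alpha_{;\mu}=G^{\bar\lambda\alpha}\,\partial^2G/\partial\bar v^\lambda\partial z^\mu$, $\delta_\mu=\partial/\partial z^\mu-\Gamma^\alpha_{;\mu}\dot\partial_\alpha$, $\delta_{\bar\mu}=\overline{\delta_\mu}$, $\delta v^\alpha=dv^\alpha+\Gamma^\alpha_{;\beta}dz^\beta$, $\Gamma^\alpha_{\beta;\mu}=G^{\bar\lambda\alpha}\delta_\mu(G_{\beta\bar\lambda})$,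 $\Gamma^\alpha_{\beta\gamma}=G^{\bar\lambda\alpha}G_{\beta\bar\lambda\gamma}$. The horizontal bundle $\mathcal H$ is spanned by the $\delta_\mu$, with Hermitian product $\langle H,K\rangle_v=G_{\alpha\bar\beta}(v)H^\alpha\bar K^\beta$. $F$ is Kähler-Finsler if $(\Gamma^\alpha_{\beta;\mu}-\Gamma^\alpha_{\mu;\beta})v^\beta=0$; by a known theorem of Chen and Shen this is equivalent to $\Gamma^\alpha_{\beta;\mu}=\Gamma^\alpha_{\mu;\beta}$. $F$ is weakly Kähler-Finsler if $G_\alpha(\Gamma^\alpha_{\beta;\mu}-\Gamma^\alpha_{\mu;\beta})v^\beta=0$. Chern-Finsler connection $D$ (on $\mathcal H$, in the frame $\delta_\alpha$): connection forms $\theta^\alpha_\beta=\Gamma^\alpha_{\beta;\mu}dz^\mu+\Gamma^\alpha_{\beta\gamma}\delta v^\gamma$; its holomorphic sectional curvature tensor is $\Omega_{\alpha\bar\beta;\mu\bar\nu}=G_{\gamma\bar\beta}\Omega^\gamma_{\alpha;\mu\bar\nu}$ with $\Omega^\alpha_{\beta;\mu\bar\nu}=-\delta_{\bar\nu}(\Gamma^\alpha_{\beta;\mu})-\Gamma^\alpha_{\beta\gamma}\delta_{\bar\nu}(\Gamma^\gamma_{;\mu})$. Canonical connection $\nabla$ (on $\mathcal H$): connection forms $\omega^\alpha_\beta=L^\alpha_{\beta\mu}dz^\mu+L^\alpha_{\beta\bar\mu}d\bar z^\mu+\Gamma^\alpha_{\beta\mu}\delta v^\mu$, where $L^\alpha_{\beta\mu}=\tfrac12G^{\bar\lambda\alpha}(\delta_\mu(G_{\beta\bar\lambda})+\delta_\beta(G_{\mu\bar\lambda}))$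 and $L^\alpha_{\beta\bar\mu}=\tfrac12G^{\bar\lambda\alpha}(\delta_{\bar\mu}(G_{\beta\bar\lambda})-\delta_{\bar\lambda}(G_{\beta\bar\mu}))$; its holomorphic sectional curvature tensor is $R_{\alpha\bar\beta\mu\bar\nu}=\langle\nabla_{\delta_\mu}\nabla_{\delta_{\bar\nu}}\delta_\alpha-\nabla_{\delta_{\bar\nu}}\nabla_{\delta_\mu}\delta_\alpha-\nabla_{[\delta_\mu,\delta_{\bar\nu}]}\delta_\alpha,\delta_\beta\rangle_v$. For $H=H^\alpha\delta_\alpha\in\mathcal H_v$ nonzero: $K_\nabla(H)=\dfrac{R_{\alpha\bar\beta\mu\bar\nu}(v)H^\alpha\bar H^\beta H^\mu\bar H^\nu}{(G_{\alpha\bar\beta}(v)H^\alpha\bar H^\beta)^2}$ and $K_D(H)=\dfrac{\Omega_{\alpha\bar\beta;\mu\bar\nu}(v)H^\alpha\bar H^\beta H^\mu\bar H^\nu}{(G_{\alpha\bar\beta}(v)H^\alpha\bar H^\beta)^2}$. For $v\in\tilde M$: $K_\nabla(v)=R_{\alpha\bar\beta\mu\bar\nu}(v)v^\alpha\bar v^\beta v^\mu\bar v^\nu/G(v)^2$ and $K_D(v)=\Omega_{\alpha\bar\beta;\mu\bar\nu}(v)v^\alpha\bar v^\beta v^\mu\bar v^\nu/G(v)^2$. *)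

theory Defs
  imports "HOL-Analysis.Analysis"
begin

section \<open>Smooth and holomorphic maps on open sets\<close>

text \<open>
  Both notions are meant for open sets \<open>S\<close> of finite-dimensional spaces. A map is of class
  \<open>C\<^sup>k\<close> iff all its iterated directional derivatives up to order \<open>k\<close> exist and are continuous.
\<close>

primrec Ck_on ::
  "nat \<Rightarrow> ('a::real_normed_vector \<Rightarrow> 'b::real_normed_vector) \<Rightarrow> 'a set \<Rightarrow> bool" where
  "Ck_on 0 f S \<longleftrightarrow> continuous_on S f"
| "Ck_on (Suc k) f S \<longleftrightarrow>
     (\<forall>x\<in>S. f differentiable (at x)) \<and> (\<forall>h. Ck_on k (\<lambda>x. frechet_derivative f (at x) h) S)"

definition smooth_on :: "('a::real_normed_vector \<Rightarrow> 'b::real_normed_vector) \<Rightarrow> 'a set \<Rightarrow> bool" where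
  "smooth_on f S \<longleftrightarrow> (\<forall>k. Ck_on k f S)"

definition holomorphic_map_on :: "(complex^'n \<Rightarrow> complex^'m) \<Rightarrow> (complex^'n) set \<Rightarrow> bool" where
  "holomorphic_map_on f S \<longleftrightarrow>
     (\<forall>x\<in>S. \<exists>D. (f has_derivative D) (at x) \<and> (\<forall>c h. D (c *s h) = c *s D h))"


section \<open>Complex manifolds and the holomorphic tangent bundle\<close>

type_synonym ('m, 'n) chart = "'m set \<times> ('m \<Rightarrow> complex^'n)"

abbreviation cdom :: "('m, 'n) chart \<Rightarrow> 'm set" where "cdom \<equiv> fst"
abbreviation crd :: "('m, 'n) chart \<Rightarrow> 'm \<Rightarrow> complex^'n" where "crd \<equiv> snd"

definition chart_inv :: "('m, 'n) chart \<Rightarrow> complex^'n \<Rightarrow> 'm" where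
  "chart_inv c = inv_into (cdom c) (crd c)"

definition transition :: "('m, 'n) chart \<Rightarrow> ('m, 'n) chart \<Rightarrow> complex^'n \<Rightarrow> complex^'n" where
  "transition c c' = crd c' \<circ> chart_inv c"

definition complex_manifold :: "'m topology \<Rightarrow> ('m, 'n::finite) chart set \<Rightarrow> bool" where
  "complex_manifold X A \<longleftrightarrow>
     Hausdorff_space X \<and> second_countable X \<and>
     (\<Union>c\<in>A. cdom c) = topspace X \<and>
     (\<forall>c\<in>A. openin X (cdom c) \<and> open (crd c ` cdom c) \<and>
            homeomorphic_map (subtopology X (cdom c))
                             (subtopology euclidean (crd c ` cdom c)) (crd c)) \<and>
     (\<forall>c\<in>A. \<forall>c'\<in>A. holomorphic_map_on (transition c c') (crd c ` (cdom c \<inter> cdom c')))"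

text \<open>
  A \<open>(1,0)\<close> tangent vector at \<open>p\<close> is the family of its coordinate vectors
  \<open>(v\<^sup>1, \<dots>, v\<^sup>n)\<close>, one for each chart around \<open>p\<close>, related by the differentials of the
  coordinate changes. The value at other charts is fixed to \<open>0\<close>, which makes the representation
  unique.
\<close>

definition tangent_space ::
  "('m, 'n::finite) chart set \<Rightarrow> 'm \<Rightarrow> (('m, 'n) chart \<Rightarrow> complex^'n) set" where
  "tangent_space A p = {\<xi>.
     (\<forall>c\<in>A. \<forall>c'\<in>A. p \<in> cdom c \<and> p \<in> cdom c' \<longrightarrow>
        \<xi> c' = frechet_derivative (transition c c') (at (crd c p)) (\<xi> c)) \<and>
     (\<forall>c. \<not> (c \<in> A \<and> p \<in> cdom c) \<longrightarrow> \<xi> c = 0)}"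

type_synonym ('m, 'n) tvec = "'m \<times> (('m, 'n) chart \<Rightarrow> complex^'n)"

definition tangent_bundle ::
  "'m topology \<Rightarrow> ('m, 'n::finite) chart set \<Rightarrow> ('m, 'n) tvec set" where
  "tangent_bundle X A = Sigma (topspace X) (tangent_space A)"

definition slit_tangent_bundle ::
  "'m topology \<Rightarrow> ('m, 'n::finite) chart set \<Rightarrow> ('m, 'n) tvec set" where
  "slit_tangent_bundle X A = {w \<in> tangent_bundle X A. snd w \<noteq> (\<lambda>_. 0)}"

definition tscale :: "complex \<Rightarrow> ('m, 'n::finite) tvec \<Rightarrow> ('m, 'n) tvec" where
  "tscale \<zeta> w = (fst w, \<lambda>c. \<zeta> *s snd w c)"

type_synonym 'n point = "(complex^'n) \<times> (complex^'n)"

text \<open>The tangent vector \<open>v\<^sup>\<alpha> \<partial>/\<partial>z\<^sup>\<alpha>\<close> at the point with coordinates \<open>z\<close> in the chart \<open>c\<close>.\<close>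

definition tvec_of ::
  "('m, 'n::finite) chart set \<Rightarrow> ('m, 'n) chart \<Rightarrow> 'n point \<Rightarrow> ('m, 'n) tvec" where
  "tvec_of A c = (\<lambda>(z, v). (chart_inv c z,
     \<lambda>c'. if c' \<in> A \<and> chart_inv c z \<in> cdom c'
           then frechet_derivative (transition c c') (at z) v else 0))"

definition bundle_topology ::
  "'m topology \<Rightarrow> ('m, 'n::finite) chart set \<Rightarrow> ('m, 'n) tvec topology" where
  "bundle_topology X A =
     topology_generated_by {tvec_of A c ` W | c W. c \<in> A \<and> open W \<and> W \<subseteq> (crd c ` cdom c) \<times> UNIV}"

text \<open>The coordinates \<open>(z, v)\<close> of the nonzero tangent vectors over the domain of the chart \<open>c\<close>.\<close>

definition slit_coords :: "('m, 'n::finite) chart \<Rightarrow> 'n point set" where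
  "slit_coords c = (crd c ` cdom c) \<times> (- {0})"

lemma chart_inv_crd:
  assumes "complex_manifold X A" "c \<in> A" "p \<in> cdom c" shows "chart_inv c (crd c p) = p"
proof -
  have "openin X (cdom c)" "homeomorphic_map (subtopology X (cdom c))
                             (subtopology euclidean (crd c ` cdom c)) (crd c)"
    using assms by (auto simp: complex_manifold_def)
  then have "inj_on (crd c) (cdom c)"
    unfolding homeomorphic_map_def by (metis topspace_subtopology_subset openin_subset)
  then show ?thesis using assms(3) by (simp add: chart_inv_def)
qed

lemma overlap_open:
  assumes "complex_manifold X A" "c \<in> A" "c' \<in> A"
  shows "open (crd c ` (cdom c \<inter> cdom c'))"
proof -
  have o: "openin X (cdom c)" "openin X (cdom c')" "open (crd c ` cdom c)"
    "homeomorphic_map (subtopology X (cdom c)) (subtopology euclidean (crd c ` cdom c)) (crd c)"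
    using assms by (auto simp: complex_manifold_def)
  have "openin (subtopology X (cdom c)) (cdom c \<inter> cdom c')"
    using o by (metis openin_subtopology_Int2)
  then have "openin (subtopology euclidean (crd c ` cdom c)) (crd c ` (cdom c \<inter> cdom c'))"
    using o(4) homeomorphic_imp_open_map open_map_def by blast
  then show ?thesis using o(3) openin_open_trans by blast
qed

lemma transition_derivative:
  assumes "complex_manifold X A" "c \<in> A" "c' \<in> A" "p \<in> cdom c" "p \<in> cdom c'"
  shows "(transition c c' has_derivative frechet_derivative (transition c c') (at (crd c p))) (at (crd c p))"
proof -
  have "holomorphic_map_on (transition c c') (crd c ` (cdom c \<inter> cdom c'))"
    using assms unfolding complex_manifold_def by blast
  then have "transition c c' differentiable (at (crd c p))"
    using assms unfolding holomorphic_map_on_def differentiable_def by blast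
  then show ?thesis by (simp add: frechet_derivative_works)
qed

lemma cocycle:
  assumes M: "complex_manifold X A" "c \<in> A" "c' \<in> A" "c'' \<in> A"
    and p: "p \<in> cdom c" "p \<in> cdom c'" "p \<in> cdom c''"
  shows "frechet_derivative (transition c c'') (at (crd c p)) v =
    frechet_derivative (transition c' c'') (at (crd c' p)) (frechet_derivative (transition c c') (at (crd c p)) v)"
proof -
  have e: "transition c c' (crd c p) = crd c' p"
    by (simp add: transition_def chart_inv_crd[OF M(1) M(2) p(1)])
  have d1: "(transition c c' has_derivative frechet_derivative (transition c c') (at (crd c p))) (at (crd c p))"
    by (rule transition_derivative[OF M(1,2,3) p(1,2)])
  have d2: "(transition c' c'' has_derivative frechet_derivative (transition c' c'') (at (crd c' p))) (at (transition c c' (crd c p)))"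
    unfolding e by (rule transition_derivative[OF M(1,3,4) p(2,3)])
  note d = diff_chain_at[OF d1 d2]
  have "(transition c c'' has_derivative (frechet_derivative (transition c' c'') (at (crd c' p)) \<circ> frechet_derivative (transition c c') (at (crd c p)))) (at (crd c p))"
  proof (rule has_derivative_transform_within_open[OF d overlap_open[OF M(1) M(2) M(3)]])
    show "crd c p \<in> crd c ` (cdom c \<inter> cdom c')" using p by blast
    fix x assume "x \<in> crd c ` (cdom c \<inter> cdom c')"
    then obtain q where q: "q \<in> cdom c" "q \<in> cdom c'" "x = crd c q" by blast
    show "(transition c' c'' \<circ> transition c c') x = transition c c'' x"
      by (simp add: transition_def q chart_inv_crd[OF M(1) M(2) q(1)] chart_inv_crd[OF M(1) M(3) q(2)])
  qed
  then show ?thesis by (metis frechet_derivative_at comp_apply)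
qed

lemma cocycle_id:
  assumes M: "complex_manifold X A" "c \<in> A" and p: "p \<in> cdom c"
  shows "frechet_derivative (transition c c) (at (crd c p)) v = v"
proof -
  have "((\<lambda>x. x) has_derivative (\<lambda>x. x)) (at (crd c p))" by simp
  then have "(transition c c has_derivative (\<lambda>x. x)) (at (crd c p))"
  proof (rule has_derivative_transform_within_open[OF _ overlap_open[OF M(1) M(2) M(2)]])
    show "crd c p \<in> crd c ` (cdom c \<inter> cdom c)" using p by blast
    fix x assume "x \<in> crd c ` (cdom c \<inter> cdom c)"
    then show "x = transition c c x" by (auto simp: transition_def chart_inv_crd[OF M(1) M(2)])
  qed
  then show ?thesis by (metis frechet_derivative_at)
qed

text \<open>The chart \<open>c\<close> identifies the slit tangent bundle over its domain with \<open>slit_coords c\<close>.\<close>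

lemma slit_coords_bij:
  assumes M: "complex_manifold X A" "c \<in> A"
  shows "bij_betw (tvec_of A c) (slit_coords c) {w \<in> slit_tangent_bundle X A. fst w \<in> cdom c}"
proof (rule bij_betw_byWitness[where f' = "\<lambda>w. (crd c (fst w), snd w c)"])
  show "\<forall>a\<in>slit_coords c. (crd c (fst (tvec_of A c a)), snd (tvec_of A c a) c) = a"
    using M cocycle_id[OF M] chart_inv_crd[OF M] by (auto simp: slit_coords_def tvec_of_def)
  have sub: "cdom c \<subseteq> topspace X" using M unfolding complex_manifold_def by blast
  show "\<forall>w\<in>{w \<in> slit_tangent_bundle X A. fst w \<in> cdom c}. tvec_of A c (crd c (fst w), snd w c) = w"
  proof
    fix w assume w: "w \<in> {w \<in> slit_tangent_bundle X A. fst w \<in> cdom c}"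
    obtain p \<xi> where pw: "w = (p, \<xi>)" by fastforce
    have h: "p \<in> cdom c" "\<xi> \<in> tangent_space A p"
      using w pw by (auto simp: slit_tangent_bundle_def tangent_bundle_def)
    have "(if c' \<in> A \<and> p \<in> cdom c'
       then frechet_derivative (transition c c') (at (crd c p)) (\<xi> c) else 0) = \<xi> c'" for c'
    proof -
      have "c' \<in> A \<and> p \<in> cdom c' \<Longrightarrow> \<xi> c' = frechet_derivative (transition c c') (at (crd c p)) (\<xi> c)"
        and "\<not> (c' \<in> A \<and> p \<in> cdom c') \<Longrightarrow> \<xi> c' = 0"
        using h M(2) unfolding tangent_space_def by blast+
      then show ?thesis by metis
    qed
    then show "tvec_of A c (crd c (fst w), snd w c) = w"
      unfolding pw tvec_of_def case_prod_conv fst_conv snd_conv chart_inv_crd[OF M h(1)] by blast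
  qed
  show "tvec_of A c ` slit_coords c \<subseteq> {w \<in> slit_tangent_bundle X A. fst w \<in> cdom c}"
  proof
    fix w assume "w \<in> tvec_of A c ` slit_coords c"
    then obtain p v where p: "p \<in> cdom c" and v: "v \<noteq> 0" and w: "w = tvec_of A c (crd c p, v)"
      by (auto simp: slit_coords_def)
    have "snd (tvec_of A c (crd c p, v)) c = v"
      using M p cocycle_id[OF M p] chart_inv_crd[OF M p] by (simp add: tvec_of_def)
    then have n: "snd (tvec_of A c (crd c p, v)) \<noteq> (\<lambda>_. 0)" using v by auto
    have "snd (tvec_of A c (crd c p, v)) \<in> tangent_space A p"
    proof -
      have "frechet_derivative (transition c c2) (at (crd c p)) v =
         frechet_derivative (transition c1 c2) (at (crd c1 p)) (frechet_derivative (transition c c1) (at (crd c p)) v)"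
        if "c1 \<in> A" "c2 \<in> A" "p \<in> cdom c1" "p \<in> cdom c2" for c1 c2
        using cocycle[OF M(1) M(2) that(1,2) p that(3,4)] .
      note this[symmetric, simp]
      show ?thesis
        unfolding tangent_space_def tvec_of_def case_prod_conv chart_inv_crd[OF M p] snd_conv mem_Collect_eq
        by (intro conjI ballI allI impI) (elim conjE, simp, meson)
    qed
    moreover have "fst w = p" by (simp add: w tvec_of_def chart_inv_crd[OF M p])
    ultimately show "w \<in> {w \<in> slit_tangent_bundle X A. fst w \<in> cdom c}"
      using n p sub unfolding w[symmetric] by (cases w) (auto simp: slit_tangent_bundle_def tangent_bundle_def)
  qed
  show "(\<lambda>w. (crd c (fst w), snd w c)) ` {w \<in> slit_tangent_bundle X A. fst w \<in> cdom c} \<subseteq> slit_coords c"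
  proof
    fix y assume "y \<in> (\<lambda>w. (crd c (fst w), snd w c)) ` {w \<in> slit_tangent_bundle X A. fst w \<in> cdom c}"
    then obtain p \<xi> where y: "y = (crd c p, \<xi> c)" and h0: "(p, \<xi>) \<in> slit_tangent_bundle X A" and h2: "p \<in> cdom c"
      by fastforce
    note h = h0 h2
    then have t: "\<xi> \<in> tangent_space A p" "\<xi> \<noteq> (\<lambda>_. 0)" by (auto simp: slit_tangent_bundle_def tangent_bundle_def)
    have "\<xi> c \<noteq> 0"
    proof
      assume z: "\<xi> c = 0"
      have "\<xi> c' = 0" for c'
      proof (cases "c' \<in> A \<and> p \<in> cdom c'")
        case True
        then have "\<xi> c' = frechet_derivative (transition c c') (at (crd c p)) 0"
          using t(1) h(2) M(2) z unfolding tangent_space_def mem_Collect_eq by metis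
        also have "\<dots> = 0" using transition_derivative[OF M(1) M(2) _ h(2)] True
          by (metis has_derivative_linear linear_0)
        finally show ?thesis .
      next
        case False then show ?thesis using t unfolding tangent_space_def by blast
      qed
      then show False using t(2) by auto
    qed
    then show "y \<in> slit_coords c" using y h2 by (simp add: slit_coords_def)
  qed
qed


section \<open>Wirtinger calculus on a coordinate domain of the tangent bundle\<close>

text \<open>
  The indices of the coordinate vector fields
  \<open>\<partial>/\<partial>z\<^sup>\<alpha>\<close>, \<open>\<partial>/\<partial>v\<^sup>\<alpha>\<close>, \<open>\<partial>/\<partial>(cnj z\<^sup>\<alpha>)\<close>, \<open>\<partial>/\<partial>(cnj v\<^sup>\<alpha>)\<close>, which form a frame of the
  complexified tangent bundle.
\<close>

datatype 'n idx = Z 'n | V 'n | Zb 'n | Vb 'n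

primrec pd :: "'n::finite idx \<Rightarrow> ('n point \<Rightarrow> complex) \<Rightarrow> 'n point \<Rightarrow> complex" where
  "pd (Z a) f p = (frechet_derivative f (at p) (axis a 1, 0)
                   - \<i> * frechet_derivative f (at p) (axis a \<i>, 0)) / 2"
| "pd (V a) f p = (frechet_derivative f (at p) (0, axis a 1)
                   - \<i> * frechet_derivative f (at p) (0, axis a \<i>)) / 2"
| "pd (Zb a) f p = (frechet_derivative f (at p) (axis a 1, 0)
                    + \<i> * frechet_derivative f (at p) (axis a \<i>, 0)) / 2"
| "pd (Vb a) f p = (frechet_derivative f (at p) (0, axis a 1)
                    + \<i> * frechet_derivative f (at p) (0, axis a \<i>)) / 2"

text \<open>Complex vector fields, given by their components in this frame.\<close>

type_synonym 'n vfield = "'n idx \<Rightarrow> 'n point \<Rightarrow> complex"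

definition vf_apply :: "'n::finite vfield \<Rightarrow> ('n point \<Rightarrow> complex) \<Rightarrow> 'n point \<Rightarrow> complex" where
  "vf_apply X f p = (\<Sum>a\<in>UNIV. X (Z a) p * pd (Z a) f p + X (V a) p * pd (V a) f p
                             + X (Zb a) p * pd (Zb a) f p + X (Vb a) p * pd (Vb a) f p)"

definition vf_bracket :: "'n::finite vfield \<Rightarrow> 'n vfield \<Rightarrow> 'n vfield" where
  "vf_bracket X Y k p = vf_apply X (Y k) p - vf_apply Y (X k) p"

primrec conj_idx :: "'n idx \<Rightarrow> 'n idx" where
  "conj_idx (Z a) = Zb a"
| "conj_idx (V a) = Vb a"
| "conj_idx (Zb a) = Z a"
| "conj_idx (Vb a) = V a"

definition vf_conj :: "'n vfield \<Rightarrow> 'n vfield" where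
  "vf_conj X k p = cnj (X (conj_idx k) p)"


section \<open>Local objects of a complex Finsler metric\<close>

text \<open>
  Throughout, \<open>G\<close> is the coordinate expression of \<open>F\<^sup>2\<close>, regarded as a complex-valued function of
  \<open>(z, v)\<close>. In the names below, a suffix \<open>b\<close> marks a barred index.
\<close>

definition G1 :: "('n::finite point \<Rightarrow> complex) \<Rightarrow> 'n \<Rightarrow> 'n point \<Rightarrow> complex" where
  "G1 G a = pd (V a) G"

definition G2 :: "('n::finite point \<Rightarrow> complex) \<Rightarrow> 'n \<Rightarrow> 'n \<Rightarrow> 'n point \<Rightarrow> complex" where
  "G2 G a b = pd (Vb b) (pd (V a) G)"

definition G3 :: "('n::finite point \<Rightarrow> complex) \<Rightarrow> 'n \<Rightarrow> 'n \<Rightarrow> 'n \<Rightarrow> 'n point \<Rightarrow> complex" where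
  "G3 G a b s = pd (V s) (G2 G a b)"

text \<open>\<open>Ginv G l a\<close> is \<open>G\<^sup>\<lambda>\<^sup>\<alpha>\<close> with barred first index \<open>\<lambda>\<close>.\<close>

definition Ginv :: "('n::finite point \<Rightarrow> complex) \<Rightarrow> 'n \<Rightarrow> 'n \<Rightarrow> 'n point \<Rightarrow> complex" where
  "Ginv G l a p = matrix_inv (\<chi> \<alpha> \<beta>. G2 G \<alpha> \<beta> p) $ l $ a"

definition levi_positive_definite :: "('n::finite point \<Rightarrow> complex) \<Rightarrow> 'n point \<Rightarrow> bool" where
  "levi_positive_definite G p \<longleftrightarrow>
     (\<forall>w::complex^'n. w \<noteq> 0 \<longrightarrow>
        (\<Sum>a\<in>UNIV. \<Sum>b\<in>UNIV. G2 G a b p * w $ a * cnj (w $ b)) \<in> \<real> \<and>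
        0 < Re (\<Sum>a\<in>UNIV. \<Sum>b\<in>UNIV. G2 G a b p * w $ a * cnj (w $ b)))"

text \<open>\<open>Gam1 G a m\<close> is \<open>\<Gamma>\<^sup>\<alpha>\<^sub>;\<^sub>\<mu>\<close>.\<close>

definition Gam1 :: "('n::finite point \<Rightarrow> complex) \<Rightarrow> 'n \<Rightarrow> 'n \<Rightarrow> 'n point \<Rightarrow> complex" where
  "Gam1 G a m p = (\<Sum>l\<in>UNIV. Ginv G l a p * pd (Vb l) (pd (Z m) G) p)"

definition delta :: "('n::finite point \<Rightarrow> complex) \<Rightarrow> 'n \<Rightarrow> 'n vfield" where
  "delta G m k p = (case k of Z a \<Rightarrow> (if a = m then 1 else 0) | V a \<Rightarrow> - Gam1 G a m p
                            | Zb a \<Rightarrow> 0 | Vb a \<Rightarrow> 0)"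

definition deltab :: "('n::finite point \<Rightarrow> complex) \<Rightarrow> 'n \<Rightarrow> 'n vfield" where
  "deltab G m = vf_conj (delta G m)"

text \<open>The one-form \<open>\<delta>v\<^sup>\<alpha>\<close> evaluated on a vector field; \<open>dz\<^sup>\<mu>(X)\<close> is just \<open>X (Z m)\<close>.\<close>

definition delta_v :: "('n::finite point \<Rightarrow> complex) \<Rightarrow> 'n \<Rightarrow> 'n vfield \<Rightarrow> 'n point \<Rightarrow> complex" where
  "delta_v G a X p = X (V a) p + (\<Sum>b\<in>UNIV. Gam1 G a b p * X (Z b) p)"

text \<open>\<open>Gam2 G a b m\<close> is \<open>\<Gamma>\<^sup>\<alpha>\<^sub>\<beta>\<^sub>;\<^sub>\<mu>\<close> and \<open>Gamv G a b c\<close> is \<open>\<Gamma>\<^sup>\<alpha>\<^sub>\<beta>\<^sub>\<gamma>\<close>.\<close>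

definition Gam2 :: "('n::finite point \<Rightarrow> complex) \<Rightarrow> 'n \<Rightarrow> 'n \<Rightarrow> 'n \<Rightarrow> 'n point \<Rightarrow> complex" where
  "Gam2 G a b m p = (\<Sum>l\<in>UNIV. Ginv G l a p * vf_apply (delta G m) (G2 G b l) p)"

definition Gamv :: "('n::finite point \<Rightarrow> complex) \<Rightarrow> 'n \<Rightarrow> 'n \<Rightarrow> 'n \<Rightarrow> 'n point \<Rightarrow> complex" where
  "Gamv G a b c p = (\<Sum>l\<in>UNIV. Ginv G l a p * G3 G b l c p)"

definition kaehler_at :: "('n::finite point \<Rightarrow> complex) \<Rightarrow> 'n point \<Rightarrow> bool" where
  "kaehler_at G p \<longleftrightarrow>
     (\<forall>a m. (\<Sum>b\<in>UNIV. (Gam2 G a b m p - Gam2 G a m b p) * snd p $ b) = 0)"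

definition weakly_kaehler_at :: "('n::finite point \<Rightarrow> complex) \<Rightarrow> 'n point \<Rightarrow> bool" where
  "weakly_kaehler_at G p \<longleftrightarrow>
     (\<forall>m. (\<Sum>a\<in>UNIV. \<Sum>b\<in>UNIV. G1 G a p * (Gam2 G a b m p - Gam2 G a m b p) * snd p $ b) = 0)"


section \<open>The horizontal bundle and the two curvature tensors\<close>

text \<open>The fibre of the horizontal bundle: all \<open>H\<^sup>\<alpha> \<delta>\<^sub>\<alpha>\<close>; then \<open>H\<^sup>\<alpha>\<close> is the component along \<open>Z \<alpha>\<close>.\<close>

definition horizontal_space :: "('n::finite point \<Rightarrow> complex) \<Rightarrow> 'n point \<Rightarrow> ('n idx \<Rightarrow> complex) set" where
  "horizontal_space G p = range (\<lambda>h::complex^'n. \<lambda>k. \<Sum>m\<in>UNIV. h $ m * delta G m k p)"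

text \<open>Sections of the horizontal bundle are given by their components in the frame \<open>\<delta>\<^sub>\<alpha>\<close>.\<close>

type_synonym 'n hsection = "'n \<Rightarrow> 'n point \<Rightarrow> complex"

definition frame_section :: "'n \<Rightarrow> 'n hsection" where
  "frame_section a b p = (if b = a then 1 else 0)"

definition hermitian_product ::
  "('n::finite point \<Rightarrow> complex) \<Rightarrow> 'n hsection \<Rightarrow> 'n hsection \<Rightarrow> 'n point \<Rightarrow> complex" where
  "hermitian_product G H K p = (\<Sum>a\<in>UNIV. \<Sum>b\<in>UNIV. G2 G a b p * H a p * cnj (K b p))"

definition L1 :: "('n::finite point \<Rightarrow> complex) \<Rightarrow> 'n \<Rightarrow> 'n \<Rightarrow> 'n \<Rightarrow> 'n point \<Rightarrow> complex" where
  "L1 G a b m p = (1/2) * (\<Sum>l\<in>UNIV. Ginv G l a p *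
     (vf_apply (delta G m) (G2 G b l) p + vf_apply (delta G b) (G2 G m l) p))"

definition L1b :: "('n::finite point \<Rightarrow> complex) \<Rightarrow> 'n \<Rightarrow> 'n \<Rightarrow> 'n \<Rightarrow> 'n point \<Rightarrow> complex" where
  "L1b G a b m p = (1/2) * (\<Sum>l\<in>UNIV. Ginv G l a p *
     (vf_apply (deltab G m) (G2 G b l) p - vf_apply (deltab G l) (G2 G b m) p))"

text \<open>\<open>omega G a b X\<close> is the connection form \<open>\<omega>\<^sup>\<alpha>\<^sub>\<beta>\<close> of the canonical connection evaluated on \<open>X\<close>.\<close>

definition omega ::
  "('n::finite point \<Rightarrow> complex) \<Rightarrow> 'n \<Rightarrow> 'n \<Rightarrow> 'n vfield \<Rightarrow> 'n point \<Rightarrow> complex" where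
  "omega G a b X p = (\<Sum>m\<in>UNIV. L1 G a b m p * X (Z m) p + L1b G a b m p * X (Zb m) p
                                 + Gamv G a b m p * delta_v G m X p)"

definition nabla :: "('n::finite point \<Rightarrow> complex) \<Rightarrow> 'n vfield \<Rightarrow> 'n hsection \<Rightarrow> 'n hsection" where
  "nabla G X s a p = vf_apply X (s a) p + (\<Sum>b\<in>UNIV. omega G a b X p * s b p)"

text \<open>The tensor \<open>R\<close> of the canonical connection, with indices in the order \<open>\<alpha>, \<beta>, \<mu>, \<nu>\<close>
  (\<open>\<beta>\<close> and \<open>\<nu>\<close> barred).\<close>

definition curv_nabla ::
  "('n::finite point \<Rightarrow> complex) \<Rightarrow> 'n \<Rightarrow> 'n \<Rightarrow> 'n \<Rightarrow> 'n \<Rightarrow> 'n point \<Rightarrow> complex" where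
  "curv_nabla G a b m n =
     hermitian_product G
       (\<lambda>c p. nabla G (delta G m) (nabla G (deltab G n) (frame_section a)) c p
            - nabla G (deltab G n) (nabla G (delta G m) (frame_section a)) c p
            - nabla G (vf_bracket (delta G m) (deltab G n)) (frame_section a) c p)
       (frame_section b)"

text \<open>The mixed curvature \<open>\<Omega>\<^sup>\<alpha>\<^sub>\<beta>\<^sub>;\<^sub>\<mu>\<^sub>\<nu>\<close> of the Chern-Finsler connection, and its lowered form.\<close>

definition Omega_up ::
  "('n::finite point \<Rightarrow> complex) \<Rightarrow> 'n \<Rightarrow> 'n \<Rightarrow> 'n \<Rightarrow> 'n \<Rightarrow> 'n point \<Rightarrow> complex" where
  "Omega_up G a b m n p = - vf_apply (deltab G n) (Gam2 G a b m) p
     - (\<Sum>c\<in>UNIV. Gamv G a b c p * vf_apply (deltab G n) (Gam1 G c m) p)"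

definition curv_D ::
  "('n::finite point \<Rightarrow> complex) \<Rightarrow> 'n \<Rightarrow> 'n \<Rightarrow> 'n \<Rightarrow> 'n \<Rightarrow> 'n point \<Rightarrow> complex" where
  "curv_D G a b m n p = (\<Sum>c\<in>UNIV. G2 G c b p * Omega_up G c a m n p)"

definition contract4 ::
  "('n::finite \<Rightarrow> 'n \<Rightarrow> 'n \<Rightarrow> 'n \<Rightarrow> 'n point \<Rightarrow> complex) \<Rightarrow> 'n point \<Rightarrow> ('n \<Rightarrow> complex) \<Rightarrow> complex" where
  "contract4 T p h = (\<Sum>a\<in>UNIV. \<Sum>b\<in>UNIV. \<Sum>m\<in>UNIV. \<Sum>n\<in>UNIV.
     T a b m n p * h a * cnj (h b) * h m * cnj (h n))"

text \<open>
  Horizontal holomorphic flag curvature of \<open>H \<in> horizontal_space G p\<close> and holomorphic sectional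
  curvature at \<open>p = (z, v)\<close> determined by a curvature tensor \<open>T\<close>.
\<close>

definition flag_curv ::
  "('n::finite point \<Rightarrow> complex) \<Rightarrow> ('n \<Rightarrow> 'n \<Rightarrow> 'n \<Rightarrow> 'n \<Rightarrow> 'n point \<Rightarrow> complex) \<Rightarrow>
   'n point \<Rightarrow> ('n idx \<Rightarrow> complex) \<Rightarrow> complex" where
  "flag_curv G T p H = contract4 T p (\<lambda>a. H (Z a))
     / (\<Sum>a\<in>UNIV. \<Sum>b\<in>UNIV. G2 G a b p * H (Z a) * cnj (H (Z b)))\<^sup>2"

definition hol_sect_curv ::
  "('n::finite point \<Rightarrow> complex) \<Rightarrow> ('n \<Rightarrow> 'n \<Rightarrow> 'n \<Rightarrow> 'n \<Rightarrow> 'n point \<Rightarrow> complex) \<Rightarrow>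
   'n point \<Rightarrow> complex" where
  "hol_sect_curv G T p = contract4 T p (\<lambda>a. snd p $ a) / (G p)\<^sup>2"


section \<open>Complex Finsler metrics\<close>

definition Gloc ::
  "('m, 'n::finite) chart set \<Rightarrow> (('m, 'n) tvec \<Rightarrow> real) \<Rightarrow> ('m, 'n) chart \<Rightarrow> 'n point \<Rightarrow> complex" where
  "Gloc A F c p = complex_of_real ((F (tvec_of A c p))\<^sup>2)"

definition complex_finsler_metric ::
  "'m topology \<Rightarrow> ('m, 'n::finite) chart set \<Rightarrow> (('m, 'n) tvec \<Rightarrow> real) \<Rightarrow> bool" where
  "complex_finsler_metric X A F \<longleftrightarrow>
     continuous_map (bundle_topology X A) euclideanreal F \<and>
     (\<forall>w \<in> tangent_bundle X A. 0 \<le> F w) \<and>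
     (\<forall>c\<in>A. smooth_on (Gloc A F c) (slit_coords c)) \<and>
     (\<forall>w \<in> slit_tangent_bundle X A. 0 < F w) \<and>
     (\<forall>w \<in> tangent_bundle X A. \<forall>\<zeta>. F (tscale \<zeta> w) = cmod \<zeta> * F w)"

definition strongly_pseudoconvex ::
  "('m, 'n::finite) chart set \<Rightarrow> (('m, 'n) tvec \<Rightarrow> real) \<Rightarrow> bool" where
  "strongly_pseudoconvex A F \<longleftrightarrow>
     (\<forall>c\<in>A. \<forall>p\<in>slit_coords c. levi_positive_definite (Gloc A F c) p)"

definition kaehler_finsler ::
  "('m, 'n::finite) chart set \<Rightarrow> (('m, 'n) tvec \<Rightarrow> real) \<Rightarrow> bool" where
  "kaehler_finsler A F \<longleftrightarrow> (\<forall>c\<in>A. \<forall>p\<in>slit_coords c. kaehler_at (Gloc A F c) p)"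

definition weakly_kaehler_finsler ::
  "('m, 'n::finite) chart set \<Rightarrow> (('m, 'n) tvec \<Rightarrow> real) \<Rightarrow> bool" where
  "weakly_kaehler_finsler A F \<longleftrightarrow> (\<forall>c\<in>A. \<forall>p\<in>slit_coords c. weakly_kaehler_at (Gloc A F c) p)"

end

theory Submission
  imports Defs
begin

text \<open>
  Everything happens in one chart. Write \<open>g\<close> for the Levi matrix \<open>G\<^bsub>\<alpha>\<beta>\<^esub>\<close> (second index
  barred) and put
  \<open>T\<^bsub>c m, b\<^esub> = (\<delta>\<^sub>m g\<^bsub>c b\<^esub> - \<delta>\<^sub>c g\<^bsub>m b\<^esub>) / 2\<close>, which is half of
  \<open>\<Gamma>\<^bsub>c;m\<^esub> - \<Gamma>\<^bsub>m;c\<^esub>\<close> with the upper index lowered. The two connections differ only through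
  \<open>T\<close>: lowering the upper index turns \<open>L\<^bsub>\<beta>\<mu>\<^esub> - \<Gamma>\<^bsub>\<beta>;\<mu>\<^esub>\<close> into \<open>- T\<close> and the mixed coefficients
  \<open>L\<close> with one barred lower index into complex conjugates of components of \<open>T\<close>.

  Subtracting the two curvature tensors and using the Leibniz rule for the lowered mixed
  coefficients leaves four terms (\<open>curvature_difference\<close>). Two of them are antisymmetric in the
  barred indices and one in the unbarred indices, so all three disappear when all four slots are
  filled with the same vector \<open>h\<close>. The fourth is a product of \<open>T\<close> with the mixed coefficients, and
  since these are conjugates of \<open>T\<close> raised by \<open>g\<close>, its contraction is minus the squared
  \<open>g\<close>-norm of the vector obtained by raising the conjugate of the covector
  \<open>\<xi>\<^sub>c = T\<^bsub>c m, b\<^esub> h\<^sup>m cnj (h\<^sup>b)\<close> (\<open>contracted_curvature_difference\<close>). The Levi form being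
  positive definite, the contracted curvatures agree at \<open>h\<close> iff \<open>\<xi> = 0\<close>.

  If this holds for every \<open>h\<close>, polarization gives \<open>T = 0\<close>, and \<open>T = 0\<close> on an open set makes the
  full tensors equal. For \<open>h = v\<close>, Euler's relation \<open>g\<^bsub>a b\<^esub> cnj (v\<^sup>b) = G\<^sub>a\<close> turns \<open>\<xi> = 0\<close> into
  the weak Kaehler condition. Finally, \<open>T = 0\<close> is equivalent to the Kaehler condition, which only
  says that \<open>T\<close> vanishes when contracted with \<open>v\<close>: by homogeneity
  \<open>\<Gamma>\<^bsub>b;m\<^esub> v\<^sup>b = \<Gamma>\<^bsub>;m\<^esub>\<close> and \<open>\<Gamma>\<^bsub>b;m\<^esub> = \<partial>\<Gamma>\<^bsub>;m\<^esub>/\<partial>v\<^sup>b\<close>, so differentiating the contracted condition along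
  the fibre expresses the antisymmetric \<open>\<Gamma>\<^bsub>c;m\<^esub> - \<Gamma>\<^bsub>m;c\<^esub>\<close> as a second fibre derivative, which is
  symmetric in \<open>c\<close> and \<open>m\<close> (\<open>kaehler_imp_symmetric\<close>).

  The analytic input is the calculus of smooth functions on open sets, in particular that the
  inverse of the Levi matrix is smooth and that second derivatives commute.
\<close>

section \<open>Symmetry of second directional derivatives\<close>

lemma directional_derivative_shift:
  fixes u :: "'a::real_normed_vector \<Rightarrow> real"
  assumes "((\<lambda>t. u (x + a *\<^sub>R k + t *\<^sub>R k)) has_real_derivative d) (at 0)"
  shows "((\<lambda>t. u (x + t *\<^sub>R k)) has_real_derivative d) (at a)"
proof -
  have "((\<lambda>t. u (x + a *\<^sub>R k + (t - a) *\<^sub>R k)) has_real_derivative d * 1) (at a)"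
    by (rule DERIV_chain2[of "\<lambda>t. u (x + a *\<^sub>R k + t *\<^sub>R k)"])
       (use assms in \<open>auto intro!: derivative_eq_intros\<close>)
  then show ?thesis by (simp add: algebra_simps)
qed

text \<open>
  The mean value theorem applied twice, first along \<open>k\<close> to the difference of \<open>u\<close> on two parallel
  segments and then along \<open>h\<close>. The second difference on the left is symmetric in \<open>h\<close> and \<open>k\<close>, so
  it is also a value of the derivative taken in the other order.
\<close>

lemma second_difference_mean_value:
  fixes u uk uhk :: "'a::real_normed_vector \<Rightarrow> real"
  assumes k: "\<And>x. x \<in> S \<Longrightarrow> ((\<lambda>t. u (x + t *\<^sub>R k)) has_real_derivative uk x) (at 0)"
    and hk: "\<And>x. x \<in> S \<Longrightarrow> ((\<lambda>t. uk (x + t *\<^sub>R h)) has_real_derivative uhk x) (at 0)"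
    and s: "s > 0"
    and S: "\<And>\<sigma> \<tau>. 0 \<le> \<sigma> \<Longrightarrow> \<sigma> \<le> s \<Longrightarrow> 0 \<le> \<tau> \<Longrightarrow> \<tau> \<le> s \<Longrightarrow> p + \<sigma> *\<^sub>R h + \<tau> *\<^sub>R k \<in> S"
  shows "\<exists>\<sigma>\<in>{0..s}. \<exists>\<tau>\<in>{0..s}.
    u (p + s *\<^sub>R h + s *\<^sub>R k) - u (p + s *\<^sub>R h) - u (p + s *\<^sub>R k) + u p = s\<^sup>2 * uhk (p + \<sigma> *\<^sub>R h + \<tau> *\<^sub>R k)"
proof -
  define \<psi> where "\<psi> t = u (p + s *\<^sub>R h + t *\<^sub>R k) - u (p + t *\<^sub>R k)" for t
  have "DERIV \<psi> t :> uk (p + s *\<^sub>R h + t *\<^sub>R k) - uk (p + t *\<^sub>R k)" if "0 \<le> t" "t \<le> s" for t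
    unfolding \<psi>_def
    by (rule DERIV_diff; rule directional_derivative_shift; rule k)
       (use S[of s t] S[of 0 t] that s in simp_all)
  then have "\<exists>z>0. z < s \<and> \<psi> s - \<psi> 0 = (s - 0) * (uk (p + s *\<^sub>R h + z *\<^sub>R k) - uk (p + z *\<^sub>R k))"
    by (intro MVT2 s)
  then obtain \<tau> where \<tau>: "0 < \<tau>" "\<tau> < s"
    and 1: "\<psi> s - \<psi> 0 = (s - 0) * (uk (p + s *\<^sub>R h + \<tau> *\<^sub>R k) - uk (p + \<tau> *\<^sub>R k))"
    by metis
  have "DERIV (\<lambda>t. uk (p + \<tau> *\<^sub>R k + t *\<^sub>R h)) t :> uhk (p + \<tau> *\<^sub>R k + t *\<^sub>R h)"
    if "0 \<le> t" "t \<le> s" for t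
    by (rule directional_derivative_shift, rule hk)
       (use S[of t \<tau>] that \<tau> in \<open>simp_all add: algebra_simps\<close>)
  then have "\<exists>z>0. z < s \<and> uk (p + \<tau> *\<^sub>R k + s *\<^sub>R h) - uk (p + \<tau> *\<^sub>R k + 0 *\<^sub>R h)
      = (s - 0) * uhk (p + \<tau> *\<^sub>R k + z *\<^sub>R h)"
    by (intro MVT2 s)
  then obtain \<sigma> where \<sigma>: "0 < \<sigma>" "\<sigma> < s"
    and 2: "uk (p + \<tau> *\<^sub>R k + s *\<^sub>R h) - uk (p + \<tau> *\<^sub>R k + 0 *\<^sub>R h)
      = (s - 0) * uhk (p + \<tau> *\<^sub>R k + \<sigma> *\<^sub>R h)"
    by metis
  have "\<psi> s - \<psi> 0 = s * (s * uhk (p + \<sigma> *\<^sub>R h + \<tau> *\<^sub>R k))"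
    using 1 2 by (simp add: algebra_simps)
  then have "u (p + s *\<^sub>R h + s *\<^sub>R k) - u (p + s *\<^sub>R h) - u (p + s *\<^sub>R k) + u p
    = s\<^sup>2 * uhk (p + \<sigma> *\<^sub>R h + \<tau> *\<^sub>R k)"
    by (simp add: \<psi>_def power2_eq_square algebra_simps)
  then show ?thesis using \<sigma> \<tau> by (intro bexI[of _ \<sigma>] bexI[of _ \<tau>]) auto
qed

text \<open>
  The same second difference, divided by \<open>s\<^sup>2\<close>, is a value of either mixed derivative at points
  close to \<open>p\<close>; continuity at \<open>p\<close> forces the two values at \<open>p\<close> to agree.
\<close>

lemma directional_derivatives_commute_real:
  fixes u uh uk uhk ukh :: "'a::real_normed_vector \<Rightarrow> real"
  assumes S: "open S" "p \<in> S"
    and h: "\<And>x. x \<in> S \<Longrightarrow> ((\<lambda>t. u (x + t *\<^sub>R h)) has_real_derivative uh x) (at 0)"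
    and k: "\<And>x. x \<in> S \<Longrightarrow> ((\<lambda>t. u (x + t *\<^sub>R k)) has_real_derivative uk x) (at 0)"
    and hk: "\<And>x. x \<in> S \<Longrightarrow> ((\<lambda>t. uk (x + t *\<^sub>R h)) has_real_derivative uhk x) (at 0)"
    and kh: "\<And>x. x \<in> S \<Longrightarrow> ((\<lambda>t. uh (x + t *\<^sub>R k)) has_real_derivative ukh x) (at 0)"
    and cont: "isCont uhk p" "isCont ukh p"
  shows "uhk p = ukh p"
proof (rule ccontr)
  assume ne: "uhk p \<noteq> ukh p"
  \<comment> \<open>Half the gap: two numbers within \<open>e\<close> of the two mixed derivatives cannot coincide.\<close>
  define e where "e = \<bar>uhk p - ukh p\<bar> / 2"
  have e: "e > 0" using ne by (simp add: e_def)
  obtain r where r: "r > 0" "ball p r \<subseteq> S" using S openE by blast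
  obtain d1 where d1: "d1 > 0" "\<And>x. dist x p < d1 \<Longrightarrow> dist (uhk x) (uhk p) < e"
    using cont(1) e unfolding continuous_at_eps_delta by blast
  obtain d2 where d2: "d2 > 0" "\<And>x. dist x p < d2 \<Longrightarrow> dist (ukh x) (ukh p) < e"
    using cont(2) e unfolding continuous_at_eps_delta by blast
  define d where "d = min r (min d1 d2)"
  have d: "d > 0" using r d1 d2 by (simp add: d_def)
  \<comment> \<open>The summand 1 keeps the denominator positive when \<open>h\<close> and \<open>k\<close> both vanish.\<close>
  define m where "m = norm h + norm k + 1"
  define s where "s = d / (2 * m)"
  have c: "m > 0" unfolding m_def by (intro add_nonneg_pos add_nonneg_nonneg) auto
  have s: "s > 0" using d c by (simp add: s_def)
  have near: "dist (p + \<sigma> *\<^sub>R h + \<tau> *\<^sub>R k) p < d"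
    if "0 \<le> \<sigma>" "\<sigma> \<le> s" "0 \<le> \<tau>" "\<tau> \<le> s" for \<sigma> \<tau>
  proof -
    have "dist (p + \<sigma> *\<^sub>R h + \<tau> *\<^sub>R k) p = norm (\<sigma> *\<^sub>R h + \<tau> *\<^sub>R k)"
      by (simp add: dist_norm)
    also have "\<dots> \<le> \<sigma> * norm h + \<tau> * norm k"
      using that by (metis abs_of_nonneg norm_scaleR norm_triangle_ineq)
    also have "\<dots> \<le> s * norm h + s * norm k"
      using that by (intro add_mono mult_right_mono) auto
    also have "\<dots> \<le> s * m" using s by (simp add: m_def algebra_simps)
    also have "\<dots> = d / 2" using c by (simp add: s_def )
    finally show ?thesis using d by simp
  qed
  have inS: "x \<in> S" if "dist x p < d" for x
    using r that by (auto simp: d_def dist_commute)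
  have "p + \<sigma> *\<^sub>R h + \<tau> *\<^sub>R k \<in> S" if "0 \<le> \<sigma>" "\<sigma> \<le> s" "0 \<le> \<tau>" "\<tau> \<le> s" for \<sigma> \<tau>
    using inS[OF near[OF that]] .
  have "\<exists>\<sigma>\<in>{0..s}. \<exists>\<tau>\<in>{0..s}.
    u (p + s *\<^sub>R h + s *\<^sub>R k) - u (p + s *\<^sub>R h) - u (p + s *\<^sub>R k) + u p = s\<^sup>2 * uhk (p + \<sigma> *\<^sub>R h + \<tau> *\<^sub>R k)"
    by (rule second_difference_mean_value[of S u k uk h uhk s p]) fact+
  then   obtain \<sigma> \<tau> where 1: "0 \<le> \<sigma>" "\<sigma> \<le> s" "0 \<le> \<tau>" "\<tau> \<le> s"
    "u (p + s *\<^sub>R h + s *\<^sub>R k) - u (p + s *\<^sub>R h) - u (p + s *\<^sub>R k) + u p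
     = s\<^sup>2 * uhk (p + \<sigma> *\<^sub>R h + \<tau> *\<^sub>R k)"
    by (auto simp only: atLeastAtMost_iff)
  have near': "dist (p + \<tau> *\<^sub>R k + \<sigma> *\<^sub>R h) p < d"
    if "0 \<le> \<sigma>" "\<sigma> \<le> s" "0 \<le> \<tau>" "\<tau> \<le> s" for \<sigma> \<tau>
    using near[OF that] by (simp add: algebra_simps)
  have "p + \<tau> *\<^sub>R k + \<sigma> *\<^sub>R h \<in> S" if "0 \<le> \<tau>" "\<tau> \<le> s" "0 \<le> \<sigma>" "\<sigma> \<le> s" for \<sigma> \<tau>
    using inS[OF near'[OF that(3,4,1,2)]] .
  have "\<exists>\<sigma>\<in>{0..s}. \<exists>\<tau>\<in>{0..s}.
    u (p + s *\<^sub>R k + s *\<^sub>R h) - u (p + s *\<^sub>R k) - u (p + s *\<^sub>R h) + u p = s\<^sup>2 * ukh (p + \<sigma> *\<^sub>R k + \<tau> *\<^sub>R h)"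
    by (rule second_difference_mean_value[of S u h uh k ukh s p]) fact+
  then   obtain \<sigma>' \<tau>' where 2: "0 \<le> \<sigma>'" "\<sigma>' \<le> s" "0 \<le> \<tau>'" "\<tau>' \<le> s"
    "u (p + s *\<^sub>R k + s *\<^sub>R h) - u (p + s *\<^sub>R k) - u (p + s *\<^sub>R h) + u p
     = s\<^sup>2 * ukh (p + \<sigma>' *\<^sub>R k + \<tau>' *\<^sub>R h)"
    by (auto simp only: atLeastAtMost_iff)
  have "s\<^sup>2 * uhk (p + \<sigma> *\<^sub>R h + \<tau> *\<^sub>R k) = s\<^sup>2 * ukh (p + \<sigma>' *\<^sub>R k + \<tau>' *\<^sub>R h)"
    using 1(5) 2(5) by (simp add: algebra_simps)
  then have "uhk (p + \<sigma> *\<^sub>R h + \<tau> *\<^sub>R k) = ukh (p + \<sigma>' *\<^sub>R k + \<tau>' *\<^sub>R h)"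
    using s by simp
  moreover have "dist (uhk (p + \<sigma> *\<^sub>R h + \<tau> *\<^sub>R k)) (uhk p) < e"
    using near[OF 1(1-4)] by (intro d1) (simp add: d_def)
  moreover have "dist (ukh (p + \<sigma>' *\<^sub>R k + \<tau>' *\<^sub>R h)) (ukh p) < e"
    using near'[OF 2(3,4,1,2)] by (intro d2) (simp add: d_def)
  ultimately show False unfolding dist_real_def e_def by argo
qed

section \<open>Smooth functions\<close>

lemma smooth_on_differentiable: "smooth_on f S \<Longrightarrow> x \<in> S \<Longrightarrow> f differentiable (at x)"
  unfolding smooth_on_def using Ck_on.simps(2)[of 0 f S] by blast

lemma smooth_on_has_derivative:
  "smooth_on f S \<Longrightarrow> x \<in> S \<Longrightarrow> (f has_derivative frechet_derivative f (at x)) (at x)"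
  using smooth_on_differentiable[of f S x] by (simp add: frechet_derivative_works)

lemma smooth_on_directional_derivative:
  "smooth_on f S \<Longrightarrow> smooth_on (\<lambda>x. frechet_derivative f (at x) h) S"
  unfolding smooth_on_def using Ck_on.simps(2)[of _ f S] by blast

lemma Ck_on_cong:
  assumes "open S" "\<And>x. x \<in> S \<Longrightarrow> f x = g x" "Ck_on k f S"
  shows "Ck_on k g S"
  using assms(2,3)
proof (induction k arbitrary: f g)
  case 0
  then show ?case using continuous_on_cong[of S S f g] by simp
next
  case (Suc k)
  have d: "(g has_derivative frechet_derivative f (at x)) (at x)" if "x \<in> S" for x
    by (rule has_derivative_transform_within_open[of f "frechet_derivative f (at x)" x UNIV, OF _ assms(1) that])
       (use Suc.prems that in \<open>auto simp: frechet_derivative_works\<close>)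
  have e: "frechet_derivative g (at x) = frechet_derivative f (at x)" if "x \<in> S" for x
    using d[OF that] by (metis frechet_derivative_at)
  have "Ck_on k (\<lambda>x. frechet_derivative g (at x) h) S" for h
    by (rule Suc.IH[of "\<lambda>x. frechet_derivative f (at x) h"]) (use e Suc.prems(2) in auto)
  then show ?case using d by (auto intro: differentiableI)
qed

lemma Ck_on_lessD: "Ck_on (Suc k) f S \<Longrightarrow> Ck_on k f S"
proof (induction k arbitrary: f)
  case 0
  then show ?case
    by (auto intro!: continuous_at_imp_continuous_on differentiable_imp_continuous_within)
next
  case (Suc k)
  show ?case
    unfolding Ck_on.simps(2)[of k f]
    using Suc.prems unfolding Ck_on.simps(2)[of "Suc k" f] by (intro conjI allI Suc.IH) auto
qed

text \<open>
  The induction step behind all closure properties below. It lets the derivative be given by a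
  formula on \<open>S\<close> only, so that the product and quotient rules can be used as they stand.
\<close>

lemma Ck_on_SucI:
  assumes "open S" "\<And>x. x \<in> S \<Longrightarrow> (f has_derivative D x) (at x)" "\<And>h. Ck_on k (\<lambda>x. D x h) S"
  shows "Ck_on (Suc k) f S"
proof -
  have "frechet_derivative f (at x) = D x" if "x \<in> S" for x
    using assms(2)[OF that] by (metis frechet_derivative_at)
  then have "Ck_on k (\<lambda>x. frechet_derivative f (at x) h) S" for h
    using assms(3) by (intro Ck_on_cong[OF assms(1) _ assms(3)]) auto
  then show ?thesis using assms(2) by (auto intro: differentiableI)
qed

lemma Ck_on_has_derivative:
  "Ck_on (Suc k) f S \<Longrightarrow> x \<in> S \<Longrightarrow> (f has_derivative frechet_derivative f (at x)) (at x)"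
  by (simp add: frechet_derivative_works)

lemma Ck_on_const: "Ck_on k (\<lambda>x. c) S"
  by (induction k arbitrary: c) auto

lemma Ck_on_linear:
  assumes "open S" "bounded_linear L" shows "Ck_on k f S \<Longrightarrow> Ck_on k (\<lambda>x. L (f x)) S"
proof (induction k arbitrary: f)
  case 0
  then show ?case using bounded_linear.continuous_on[OF assms(2)] by simp
next
  case (Suc k)
  show ?case
    by (rule Ck_on_SucI[OF assms(1), of _ "\<lambda>x h. L (frechet_derivative f (at x) h)"])
       (use Suc bounded_linear.has_derivative[OF assms(2) Ck_on_has_derivative[OF Suc.prems]] in auto)
qed

lemma Ck_on_add:
  assumes "open S" shows "Ck_on k f S \<Longrightarrow> Ck_on k g S \<Longrightarrow> Ck_on k (\<lambda>x. f x + g x) S"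
proof (induction k arbitrary: f g)
  case 0
  then show ?case by (simp add: continuous_on_add)
next
  case (Suc k)
  show ?case
    by (rule Ck_on_SucI[OF assms(1)])
       (use Suc has_derivative_add[OF Ck_on_has_derivative[OF Suc.prems(1)] Ck_on_has_derivative[OF Suc.prems(2)]] in auto)
qed

lemma Ck_on_mult:
  fixes f g :: "'a::real_normed_vector \<Rightarrow> 'b::real_normed_algebra"
  assumes "open S" shows "Ck_on k f S \<Longrightarrow> Ck_on k g S \<Longrightarrow> Ck_on k (\<lambda>x. f x * g x) S"
proof (induction k arbitrary: f g)
  case 0
  then show ?case by (simp add: continuous_on_mult)
next
  case (Suc k)
  show ?case
  proof (rule Ck_on_SucI[OF assms(1)])
    show "((\<lambda>x. f x * g x) has_derivative
       (\<lambda>h. f x * frechet_derivative g (at x) h + frechet_derivative f (at x) h * g x)) (at x)"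
      if "x \<in> S" for x
      using that has_derivative_mult[OF Ck_on_has_derivative[OF Suc.prems(1)] Ck_on_has_derivative[OF Suc.prems(2)]]
      by blast
    show "Ck_on k (\<lambda>x. f x * frechet_derivative g (at x) h + frechet_derivative f (at x) h * g x) S" for h
      using Suc.prems Suc.prems[THEN Ck_on_lessD] by (intro Ck_on_add[OF assms(1)] Suc.IH) auto
  qed
qed

lemma Ck_on_inverse:
  fixes f :: "'a::real_normed_vector \<Rightarrow> 'b::real_normed_field"
  assumes "open S" "\<And>x. x \<in> S \<Longrightarrow> f x \<noteq> 0"
  shows "Ck_on k f S \<Longrightarrow> Ck_on k (\<lambda>x. inverse (f x)) S"
proof (induction k)
  case 0
  then show ?case using assms(2) by (simp add: continuous_on_inverse)
next
  case (Suc k)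
  show ?case
  proof (rule Ck_on_SucI[OF assms(1)])
    show "((\<lambda>x. inverse (f x)) has_derivative
       (\<lambda>h. (- 1) * (inverse (f x) * frechet_derivative f (at x) h * inverse (f x)))) (at x)"
      if "x \<in> S" for x
      using Deriv.has_derivative_inverse[OF assms(2)[OF that] Ck_on_has_derivative[OF Suc.prems that]] by simp
    have i: "Ck_on k (\<lambda>x. inverse (f x)) S" by (rule Suc.IH[OF Ck_on_lessD[OF Suc.prems]])
    show "Ck_on k (\<lambda>x. (- 1) * (inverse (f x) * frechet_derivative f (at x) h * inverse (f x))) S" for h
      using Suc.prems by (intro Ck_on_mult[OF assms(1)] Ck_on_const i) auto
  qed
qed

lemma smooth_on_const [simp]: "smooth_on (\<lambda>x. c) S"
  by (simp add: smooth_on_def Ck_on_const)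

lemma smooth_on_add: "open S \<Longrightarrow> smooth_on f S \<Longrightarrow> smooth_on g S \<Longrightarrow> smooth_on (\<lambda>x. f x + g x) S"
  by (simp add: smooth_on_def Ck_on_add)

lemma smooth_on_mult:
  fixes f g :: "'a::real_normed_vector \<Rightarrow> 'b::real_normed_algebra"
  shows "open S \<Longrightarrow> smooth_on f S \<Longrightarrow> smooth_on g S \<Longrightarrow> smooth_on (\<lambda>x. f x * g x) S"
  by (simp add: smooth_on_def Ck_on_mult)

lemma smooth_on_linear: "open S \<Longrightarrow> bounded_linear L \<Longrightarrow> smooth_on f S \<Longrightarrow> smooth_on (\<lambda>x. L (f x)) S"
  by (simp add: smooth_on_def Ck_on_linear)

lemma smooth_on_minus: "open S \<Longrightarrow> smooth_on f S \<Longrightarrow> smooth_on (\<lambda>x. - f x) S"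
  by (rule smooth_on_linear[of S uminus f]) (simp_all add: bounded_linear_minus bounded_linear_ident)

lemma smooth_on_diff: "open S \<Longrightarrow> smooth_on f S \<Longrightarrow> smooth_on g S \<Longrightarrow> smooth_on (\<lambda>x. f x - g x) S"
  using smooth_on_add[of S f "\<lambda>x. - g x"] by (simp add: smooth_on_minus)

lemma smooth_on_cnj: "open S \<Longrightarrow> smooth_on f S \<Longrightarrow> smooth_on (\<lambda>x. cnj (f x)) S"
  by (rule smooth_on_linear[of S cnj f]) (simp_all add: bounded_linear_cnj)

lemma smooth_on_inverse:
  fixes f :: "'a::real_normed_vector \<Rightarrow> 'b::real_normed_field"
  shows "open S \<Longrightarrow> (\<And>x. x \<in> S \<Longrightarrow> f x \<noteq> 0) \<Longrightarrow> smooth_on f S \<Longrightarrow> smooth_on (\<lambda>x. inverse (f x)) S"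
  by (simp add: smooth_on_def Ck_on_inverse)

lemma smooth_on_sum:
  "open S \<Longrightarrow> (\<And>i. i \<in> I \<Longrightarrow> smooth_on (f i) S) \<Longrightarrow> smooth_on (\<lambda>x. \<Sum>i\<in>I. f i x) S"
  by (induction I rule: infinite_finite_induct) (auto intro: smooth_on_add)

lemma smooth_on_prod:
  fixes f :: "'i \<Rightarrow> 'a::real_normed_vector \<Rightarrow> 'b::{real_normed_algebra,comm_ring_1}"
  shows "open S \<Longrightarrow> (\<And>i. i \<in> I \<Longrightarrow> smooth_on (f i) S) \<Longrightarrow> smooth_on (\<lambda>x. \<Prod>i\<in>I. f i x) S"
  by (induction I rule: infinite_finite_induct) (auto intro: smooth_on_mult)

lemma smooth_on_cong:
  "open S \<Longrightarrow> (\<And>x. x \<in> S \<Longrightarrow> f x = g x) \<Longrightarrow> smooth_on f S \<Longrightarrow> smooth_on g S"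
  using Ck_on_cong unfolding smooth_on_def by blast

lemma smooth_on_continuous: "smooth_on f S \<Longrightarrow> continuous_on S f"
  unfolding smooth_on_def using Ck_on.simps(1)[of f S] by blast

text \<open>
  The mean value theorem needs real values; a complex function is treated through its real and
  imaginary part, which is what the functional \<open>L\<close> stands for.
\<close>

lemma smooth_directional_derivatives_commute:
  fixes f :: "'a::real_normed_vector \<Rightarrow> complex"
  assumes S: "open S" "p \<in> S" and f: "smooth_on f S"
  shows "frechet_derivative (\<lambda>x. frechet_derivative f (at x) k) (at p) h
       = frechet_derivative (\<lambda>x. frechet_derivative f (at x) h) (at p) k"
proof -
  have line: "((\<lambda>t. L (g (x + t *\<^sub>R e))) has_real_derivative L (frechet_derivative g (at x) e)) (at 0)"
    if "smooth_on g S" "x \<in> S" "bounded_linear L"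
    for g :: "'a \<Rightarrow> complex" and x e and L :: "complex \<Rightarrow> real"
  proof -
    have "((\<lambda>t. x + t *\<^sub>R e) has_derivative (\<lambda>t. t *\<^sub>R e)) (at 0)"
      by (auto intro!: derivative_eq_intros)
    moreover have "(g has_derivative frechet_derivative g (at x)) (at (x + 0 *\<^sub>R e))"
      using smooth_on_has_derivative that by simp
    ultimately have "((\<lambda>t. g (x + t *\<^sub>R e)) has_derivative (\<lambda>t. frechet_derivative g (at x) (t *\<^sub>R e))) (at 0)"
      by (rule has_derivative_compose)
    then have "((\<lambda>t. L (g (x + t *\<^sub>R e))) has_derivative (\<lambda>t. L (frechet_derivative g (at x) (t *\<^sub>R e)))) (at 0)"
      by (rule bounded_linear.has_derivative[OF that(3)])
    moreover have "L (frechet_derivative g (at x) (t *\<^sub>R e)) = L (frechet_derivative g (at x) e) * t" for t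
      using linear_frechet_derivative[OF smooth_on_differentiable[OF that(1,2)]] that(3)
      by (simp add: linear_cmul bounded_linear.linear)
    ultimately show ?thesis by (simp add: has_field_derivative_def)
  qed
  have "L (frechet_derivative (\<lambda>x. frechet_derivative f (at x) k) (at p) h)
       = L (frechet_derivative (\<lambda>x. frechet_derivative f (at x) h) (at p) k)"
    if L: "bounded_linear L" for L :: "complex \<Rightarrow> real"
  proof (rule directional_derivatives_commute_real[OF S,
        where u = "\<lambda>x. L (f x)" and h = h and k = k
        and uh = "\<lambda>x. L (frechet_derivative f (at x) h)"
        and uk = "\<lambda>x. L (frechet_derivative f (at x) k)"
        and uhk = "\<lambda>x. L (frechet_derivative (\<lambda>x. frechet_derivative f (at x) k) (at x) h)"
        and ukh = "\<lambda>x. L (frechet_derivative (\<lambda>x. frechet_derivative f (at x) h) (at x) k)"])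
    have f2: "smooth_on (\<lambda>x. frechet_derivative (\<lambda>x. frechet_derivative f (at x) a) (at x) b) S" for a b
      by (intro smooth_on_directional_derivative f)
    have "isCont (\<lambda>x. L (frechet_derivative (\<lambda>x. frechet_derivative f (at x) a) (at x) b)) p" for a b
      using smooth_on_continuous[OF smooth_on_linear[OF S(1) L f2]] S
      by (simp add: continuous_on_eq_continuous_at)
    then show "isCont (\<lambda>x. L (frechet_derivative (\<lambda>x. frechet_derivative f (at x) k) (at x) h)) p"
      "isCont (\<lambda>x. L (frechet_derivative (\<lambda>x. frechet_derivative f (at x) h) (at x) k)) p" by auto
    have f1: "smooth_on (\<lambda>x. frechet_derivative f (at x) a) S" for a
      by (intro smooth_on_directional_derivative f)
    fix x assume x: "x \<in> S"
    show "((\<lambda>t. L (f (x + t *\<^sub>R h))) has_real_derivative L (frechet_derivative f (at x) h)) (at 0)"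
      "((\<lambda>t. L (f (x + t *\<^sub>R k))) has_real_derivative L (frechet_derivative f (at x) k)) (at 0)"
      by (rule line[OF f x L])+
    show "((\<lambda>t. L (frechet_derivative f (at (x + t *\<^sub>R h)) k)) has_real_derivative
        L (frechet_derivative (\<lambda>x. frechet_derivative f (at x) k) (at x) h)) (at 0)"
      "((\<lambda>t. L (frechet_derivative f (at (x + t *\<^sub>R k)) h)) has_real_derivative
        L (frechet_derivative (\<lambda>x. frechet_derivative f (at x) h) (at x) k)) (at 0)"
      by (rule line[OF f1 x L])+
  qed
  from this[OF bounded_linear_Re] this[OF bounded_linear_Im] show ?thesis
    by (simp add: complex_eq_iff)
qed

section \<open>Wirtinger derivatives and complex vector fields\<close>

text \<open>
  A Wirtinger derivative is half of a combination of two real directional derivatives. Naming the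
  directions and the coefficient allows one proof for all four kinds of index.
\<close>

primrec re_dir :: "'n::finite idx \<Rightarrow> 'n point" where
  "re_dir (Z a) = (axis a 1, 0)"
| "re_dir (V a) = (0, axis a 1)"
| "re_dir (Zb a) = (axis a 1, 0)"
| "re_dir (Vb a) = (0, axis a 1)"

primrec im_dir :: "'n::finite idx \<Rightarrow> 'n point" where
  "im_dir (Z a) = (axis a \<i>, 0)"
| "im_dir (V a) = (0, axis a \<i>)"
| "im_dir (Zb a) = (axis a \<i>, 0)"
| "im_dir (Vb a) = (0, axis a \<i>)"

primrec im_coeff :: "'n idx \<Rightarrow> complex" where
  "im_coeff (Z a) = - \<i>"
| "im_coeff (V a) = - \<i>"
| "im_coeff (Zb a) = \<i>"
| "im_coeff (Vb a) = \<i>"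

lemma pd_eq_real_derivatives:
  "pd i f p = (frechet_derivative f (at p) (re_dir i) + im_coeff i * frechet_derivative f (at p) (im_dir i)) / 2"
  by (cases i) auto

lemma pd_of_has_derivative:
  "(f has_derivative D) (at p) \<Longrightarrow> pd i f p = (D (re_dir i) + im_coeff i * D (im_dir i)) / 2"
  using frechet_derivative_at[of f D p] by (simp add: pd_eq_real_derivatives)

lemma pd_const [simp]: "pd i (\<lambda>p. c) p = 0"
  by (simp add: pd_eq_real_derivatives)

lemma pd_add:
  assumes "f differentiable (at p)" "g differentiable (at p)"
  shows "pd i (\<lambda>p. f p + g p) p = pd i f p + pd i g p"
  using has_derivative_add[OF assms[unfolded frechet_derivative_works]]
  by (simp add: pd_of_has_derivative pd_eq_real_derivatives[of i f] pd_eq_real_derivatives[of i g] algebra_simps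
      add_divide_distrib)

lemma pd_mult:
  assumes "f differentiable (at p)" "g differentiable (at p)"
  shows "pd i (\<lambda>p. f p * g p) p = pd i f p * g p + f p * pd i g p"
  using has_derivative_mult[OF assms[unfolded frechet_derivative_works]]
  by (simp add: pd_of_has_derivative pd_eq_real_derivatives[of i f] pd_eq_real_derivatives[of i g] algebra_simps
      add_divide_distrib)

lemma pd_minus:
  assumes "f differentiable (at p)"
  shows "pd i (\<lambda>p. - f p) p = - pd i f p"
  using has_derivative_minus[OF assms[unfolded frechet_derivative_works]]
  by (simp add: pd_of_has_derivative pd_eq_real_derivatives[of i f] algebra_simps)

lemma pd_sum:
  assumes "\<And>j. j \<in> J \<Longrightarrow> f j differentiable (at p)"
  shows "pd i (\<lambda>p. \<Sum>j\<in>J. f j p) p = (\<Sum>j\<in>J. pd i (f j) p)"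
  using assms
proof (induction J rule: infinite_finite_induct)
  case (insert x F)
  have "(\<lambda>p. \<Sum>j\<in>F. f j p) differentiable (at p)"
    using insert by (intro differentiable_sum) auto
  then show ?case using insert by (simp add: pd_add)
qed auto

lemma pd_cnj:
  assumes "f differentiable (at p)"
  shows "pd i (\<lambda>p. cnj (f p)) p = cnj (pd (conj_idx i) f p)"
proof -
  have "((\<lambda>p. cnj (f p)) has_derivative (\<lambda>h. cnj (frechet_derivative f (at p) h))) (at p)"
    using assms frechet_derivative_works has_derivative_cnj by blast
  then show ?thesis
    by (subst pd_of_has_derivative, assumption) (cases i; simp)
qed

lemma pd_cong:
  assumes "open S" "p \<in> S" "\<And>x. x \<in> S \<Longrightarrow> f x = g x" "f differentiable (at p)"
  shows "pd i f p = pd i g p"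
proof -
  have "(g has_derivative frechet_derivative f (at p)) (at p)"
    using has_derivative_transform_within_open[of f "frechet_derivative f (at p)" p UNIV S g]
      assms frechet_derivative_works by blast
  then show ?thesis using pd_of_has_derivative pd_eq_real_derivatives by metis
qed

lemma smooth_on_pd:
  assumes "open S" "smooth_on f S" shows "smooth_on (pd i f) S"
proof -
  have "smooth_on (\<lambda>p. (frechet_derivative f (at p) (re_dir i)
      + im_coeff i * frechet_derivative f (at p) (im_dir i)) * inverse 2) S"
    by (intro smooth_on_mult smooth_on_add smooth_on_const smooth_on_directional_derivative assms)
  then show ?thesis
    by (rule smooth_on_cong[OF assms(1), rotated]) (simp add: pd_eq_real_derivatives field_simps)
qed

lemma pd_commute:
  assumes S: "open S" "p \<in> S" and f: "smooth_on f S"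
  shows "pd i (pd j f) p = pd j (pd i f) p"
proof -
  have *: "pd i (pd j f) p =
    (frechet_derivative (\<lambda>x. frechet_derivative f (at x) (re_dir j)) (at p) (re_dir i)
     + im_coeff j * frechet_derivative (\<lambda>x. frechet_derivative f (at x) (im_dir j)) (at p) (re_dir i)
     + im_coeff i * frechet_derivative (\<lambda>x. frechet_derivative f (at x) (re_dir j)) (at p) (im_dir i)
     + im_coeff i * im_coeff j *
        frechet_derivative (\<lambda>x. frechet_derivative f (at x) (im_dir j)) (at p) (im_dir i)) / 4" for i j
  proof -
    have d: "((\<lambda>x. frechet_derivative f (at x) h) has_derivative
       frechet_derivative (\<lambda>x. frechet_derivative f (at x) h) (at p)) (at p)" for h
      using smooth_on_has_derivative[OF smooth_on_directional_derivative[OF f] S(2)] .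
    have "(pd j f has_derivative (\<lambda>e.
        (frechet_derivative (\<lambda>x. frechet_derivative f (at x) (re_dir j)) (at p) e
         + im_coeff j * frechet_derivative (\<lambda>x. frechet_derivative f (at x) (im_dir j)) (at p) e) * (1/2))) (at p)"
    proof -
      have "pd j f = (\<lambda>x. (frechet_derivative f (at x) (re_dir j)
          + im_coeff j * frechet_derivative f (at x) (im_dir j)) * (1/2))"
        by (simp add: fun_eq_iff pd_eq_real_derivatives)
      moreover have "((\<lambda>x. (frechet_derivative f (at x) (re_dir j)
          + im_coeff j * frechet_derivative f (at x) (im_dir j)) * (1/2)) has_derivative (\<lambda>e.
        (frechet_derivative (\<lambda>x. frechet_derivative f (at x) (re_dir j)) (at p) e
         + im_coeff j * frechet_derivative (\<lambda>x. frechet_derivative f (at x) (im_dir j)) (at p) e) * (1/2))) (at p)"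
        by (rule has_derivative_mult_left, rule has_derivative_add[OF d], rule has_derivative_mult_right[OF d])
      ultimately show ?thesis by (simp only:)
    qed
    from pd_of_has_derivative[OF this, of i] show ?thesis
      by (simp add: algebra_simps add_divide_distrib)
  qed
  show ?thesis
    unfolding *[of i j] *[of j i]
      smooth_directional_derivatives_commute[OF S f, of "re_dir i"]
      smooth_directional_derivatives_commute[OF S f, of "im_dir i"]
    by (simp add: algebra_simps add_divide_distrib)
qed

lemma smooth_on_fibre_coordinate:
  assumes "open S" shows "smooth_on (\<lambda>p::'n::finite point. snd p $ b) S"
proof -
  have L: "bounded_linear (\<lambda>p::'n point. snd p $ b)"
    using bounded_linear_compose[OF bounded_linear_vec_nth bounded_linear_snd] .
  have "smooth_on (\<lambda>p::'n point. snd p $ b) S"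
    unfolding smooth_on_def
  proof
    fix k show "Ck_on k (\<lambda>p::'n point. snd p $ b) S"
    proof (cases k)
      case 0
      then show ?thesis using L by (simp add: linear_continuous_on)
    next
      case (Suc l)
      then show ?thesis
        using Ck_on_SucI[OF assms bounded_linear_imp_has_derivative[OF L] Ck_on_const] by blast
    qed
  qed
  then show ?thesis .
qed

lemma pd_fibre_coordinate:
  fixes p :: "'n::finite point"
  shows "pd i (\<lambda>p. snd p $ b) p = (if i = V b then 1 else 0)"
proof -
  have "bounded_linear (\<lambda>p::'n point. snd p $ b)"
    using bounded_linear_compose[OF bounded_linear_vec_nth bounded_linear_snd] .
  then have "((\<lambda>p::'n point. snd p $ b) has_derivative (\<lambda>p. snd p $ b)) (at p)"
    by (rule bounded_linear_imp_has_derivative)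
  then show ?thesis by (subst pd_of_has_derivative, assumption) (cases i; simp add: axis_def)
qed

text \<open>
  The radial operator \<open>v\<^sup>b \<partial>/\<partial>v\<^sup>b\<close> is the \<open>(1,0)\<close> part of the derivative along \<open>v\<close>: it sees
  a real-linear map \<open>D\<close> only through its values on \<open>v\<close> and on \<open>\<i> v\<close>.
\<close>

lemma linear_complexify_fibre:
  fixes D :: "'n::finite point \<Rightarrow> complex"
  assumes "linear D"
  shows "(\<Sum>b\<in>UNIV. v $ b * ((D (0, axis b 1) - \<i> * D (0, axis b \<i>)) / 2))
       = (D (0, v) - \<i> * D (0, \<i> *s v)) / 2"
proof -
  define E where "E w = D (0, w)" for w
  have E: "linear E"
    unfolding E_def
    by (rule linearI) (metis add.right_neutral add_Pair assms linear_add,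
        metis assms linear_cmul scaleR_Pair scaleR_zero_right)
  have ax: "E (axis b c) = Re c *\<^sub>R E (axis b 1) + Im c *\<^sub>R E (axis b \<i>)" for b c
  proof -
    have "axis b c = Re c *\<^sub>R axis b 1 + Im c *\<^sub>R axis b \<i>"
      by (auto simp: vec_eq_iff axis_def complex_eq_iff)
    then show ?thesis using E by (simp add: linear_add linear_cmul)
  qed
  have ex: "E w = (\<Sum>b\<in>UNIV. E (axis b (w $ b)))" for w
  proof -
    have "w = (\<Sum>b\<in>UNIV. axis b (w $ b))" by (auto simp: vec_eq_iff axis_def)
    then show ?thesis using linear_sum[OF E, of "\<lambda>b. axis b (w $ b)" UNIV] by simp
  qed
  have "v $ b * ((E (axis b 1) - \<i> * E (axis b \<i>)) / 2)
      = (E (axis b (v $ b)) - \<i> * E (axis b (\<i> * v $ b))) / 2" for b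
    by (subst ax[of b "v $ b"], subst ax[of b "\<i> * v $ b"])
       (simp add: complex_eq_iff algebra_simps scaleR_conv_of_real add_divide_distrib diff_divide_distrib)
  then show ?thesis
    by (simp add: ex[of v] ex[of "\<i> *s v"] sum_subtractf sum_distrib_left flip: E_def sum_divide_distrib)
qed

lemma vf_apply_const [simp]: "vf_apply X (\<lambda>p. c) p = 0"
  by (simp add: vf_apply_def)

lemma vf_apply_add:
  assumes "f differentiable (at p)" "g differentiable (at p)"
  shows "vf_apply X (\<lambda>p. f p + g p) p = vf_apply X f p + vf_apply X g p"
  unfolding vf_apply_def pd_add[OF assms] sum.distrib[symmetric]
  by (rule sum.cong) (simp_all add: algebra_simps)

lemma vf_apply_minus:
  assumes "f differentiable (at p)"
  shows "vf_apply X (\<lambda>p. - f p) p = - vf_apply X f p"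
  unfolding vf_apply_def pd_minus[OF assms] sum_negf[symmetric]
  by (rule sum.cong) (simp_all add: algebra_simps)

lemma vf_apply_diff:
  assumes "f differentiable (at p)" "g differentiable (at p)"
  shows "vf_apply X (\<lambda>p. f p - g p) p = vf_apply X f p - vf_apply X g p"
  using vf_apply_add[of f p "\<lambda>p. - g p" X] assms by (simp add: vf_apply_minus)

lemma vf_apply_mult:
  assumes "f differentiable (at p)" "g differentiable (at p)"
  shows "vf_apply X (\<lambda>p. f p * g p) p = vf_apply X f p * g p + f p * vf_apply X g p"
  unfolding vf_apply_def pd_mult[OF assms] sum_distrib_left sum_distrib_right sum.distrib[symmetric]
  by (rule sum.cong) (simp_all add: algebra_simps)

lemma vf_apply_sum:
  assumes "\<And>j. j \<in> J \<Longrightarrow> f j differentiable (at p)"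
  shows "vf_apply X (\<lambda>p. \<Sum>j\<in>J. f j p) p = (\<Sum>j\<in>J. vf_apply X (f j) p)"
  using assms
proof (induction J rule: infinite_finite_induct)
  case (insert x F)
  have "(\<lambda>p. \<Sum>j\<in>F. f j p) differentiable (at p)"
    using insert by (intro differentiable_sum) auto
  then show ?case using insert by (simp add: vf_apply_add)
qed auto

lemma vf_apply_cong:
  assumes "open S" "p \<in> S" "\<And>x. x \<in> S \<Longrightarrow> f x = g x" "f differentiable (at p)"
  shows "vf_apply X f p = vf_apply X g p"
proof -
  have "pd i f p = pd i g p" for i by (rule pd_cong[of S]) fact+
  then show ?thesis by (simp add: vf_apply_def)
qed

lemma vf_apply_conj:
  assumes "f differentiable (at p)"
  shows "vf_apply (vf_conj X) (\<lambda>p. cnj (f p)) p = cnj (vf_apply X f p)"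
  unfolding vf_apply_def vf_conj_def pd_cnj[OF assms] cnj_sum
  by (rule sum.cong) (simp_all add: algebra_simps)

lemma smooth_on_vf_apply:
  assumes "open S" "\<And>k. smooth_on (X k) S" "smooth_on f S"
  shows "smooth_on (vf_apply X f) S"
proof -
  have "smooth_on (\<lambda>p. vf_apply X f p) S"
    unfolding vf_apply_def
    by (intro smooth_on_sum smooth_on_add smooth_on_mult smooth_on_pd assms)
  then show ?thesis by simp
qed

section \<open>Smoothness of the inverse matrix\<close>

lemma matrix_inv_left_right:
  fixes M :: "complex^'n::finite^'n"
  assumes "invertible M"
  shows "M ** matrix_inv M = mat 1" "matrix_inv M ** M = mat 1"
  using someI_ex[OF assms[unfolded invertible_def]] by (auto simp: matrix_inv_def)

text \<open>
  Cramer's rule writes the entries of the inverse as quotients of polynomials in the entries of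
  the matrix, from which smoothness is immediate.
\<close>

lemma matrix_inv_nth_cramer:
  fixes M :: "complex^'n::finite^'n"
  assumes "invertible M"
  shows "matrix_inv M $ i $ j =
    det (\<chi> r c. if c = i then (if r = j then 1 else 0) else M $ r $ c) * inverse (det M)"
proof -
  have d: "det M \<noteq> 0" using assms invertible_det_nz by blast
  have "M *v (matrix_inv M *v axis j 1) = axis j 1"
    by (simp add: matrix_vector_mul_assoc matrix_inv_left_right assms)
  then have "matrix_inv M *v axis j 1 = (\<chi> k. det (\<chi> r c. if c = k then axis j 1 $ r else M $ r $ c) / det M)"
    using cramer[OF d] by blast
  moreover have "(matrix_inv M *v axis j 1) $ i = matrix_inv M $ i $ j"
    by (simp add: matrix_vector_mult_def axis_def if_distrib cong: if_cong)
  ultimately show ?thesis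
    by (simp add: axis_def eq_commute divide_inverse cong: if_cong)
qed

lemma smooth_on_det:
  fixes M :: "'a::real_normed_vector \<Rightarrow> complex^'n::finite^'n"
  assumes "open S" "\<And>i j. smooth_on (\<lambda>p. M p $ i $ j) S"
  shows "smooth_on (\<lambda>p. det (M p)) S"
  unfolding det_def by (intro smooth_on_sum smooth_on_mult smooth_on_prod smooth_on_const assms)

lemma smooth_on_matrix_inv:
  fixes M :: "'a::real_normed_vector \<Rightarrow> complex^'n::finite^'n"
  assumes "open S" "\<And>i j. smooth_on (\<lambda>p. M p $ i $ j) S" "\<And>p. p \<in> S \<Longrightarrow> invertible (M p)"
  shows "smooth_on (\<lambda>p. matrix_inv (M p) $ i $ j) S"
proof -
  have e: "smooth_on (\<lambda>p. (\<chi> r c. if c = i then (if r = j then 1 else 0) else M p $ r $ c) $ r $ c) S" for r c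
    using assms(2)[of r c] by (cases "c = i"; cases "r = j") simp_all
  have "smooth_on (\<lambda>p. det (\<chi> r c. if c = i then (if r = j then 1 else 0) else M p $ r $ c) * inverse (det (M p))) S"
    by (intro smooth_on_mult smooth_on_inverse smooth_on_det e assms)
       (use assms(3) invertible_det_nz in blast)
  then show ?thesis
    by (rule smooth_on_cong[OF assms(1), rotated]) (simp add: matrix_inv_nth_cramer assms(3))
qed

text \<open>
  From here on Wirtinger derivatives are handled by the rules of the calculus only, never through
  the underlying real derivative.
\<close>

declare pd.simps [simp del]

section \<open>Sesquilinear forms and contractions of curvature tensors\<close>

text \<open>
  Polarization: test vectors with at most two nonzero entries \<open>1\<close> and \<open>c\<close>, where \<open>c = 0\<close> isolates
  the diagonal and \<open>c = 1, \<i>\<close> separate the two off-diagonal entries.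
\<close>

lemma sesquilinear_form_eq_0:
  fixes h :: "'n::finite \<Rightarrow> 'n \<Rightarrow> complex"
  assumes "\<And>w :: 'n \<Rightarrow> complex. (\<Sum>a\<in>UNIV. \<Sum>b\<in>UNIV. h a b * w a * cnj (w b)) = 0"
  shows "h i j = 0"
proof -
  have Q: "h i i + h i j * cnj c + h j i * c + h j j * c * cnj c = 0" for i j c
  proof -
    define w where "w k = (if k = i then 1 else 0) + (if k = j then c else 0)" for k
    have *: "h a b * w a * cnj (w b) =
        (if a = i then (if b = i then h i i else 0) else 0)
      + (if a = i then (if b = j then h i j * cnj c else 0) else 0)
      + (if a = j then (if b = i then h j i * c else 0) else 0)
      + (if a = j then (if b = j then h j j * c * cnj c else 0) else 0)" for a b
      by (auto simp: w_def algebra_simps)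
    have i: "(\<Sum>b\<in>UNIV. if a = k then (if b = l then x else 0) else 0) = (if a = k then x else 0)"
      for a k l :: 'n and x :: complex by simp
    show ?thesis using assms[of w] unfolding * by (simp add: sum.distrib i)
  qed
  have d: "h i i = 0" for i using Q[of i i 0] by simp
  have "h i j + h j i = 0" "- (h i j * \<i>) + h j i * \<i> = 0"
    using Q[of i j 1] Q[of i j \<i>] by (simp_all add: d)
  then show ?thesis by (simp add: complex_eq_iff)
qed

lemma sum_antisymmetric_eq_0:
  fixes Y :: "'n::finite \<Rightarrow> 'n \<Rightarrow> complex"
  assumes "\<And>a m. Y m a = - Y a m"
  shows "(\<Sum>a\<in>UNIV. \<Sum>m\<in>UNIV. Y a m) = 0"
proof -
  have "(\<Sum>a\<in>UNIV. \<Sum>m\<in>UNIV. Y a m) = (\<Sum>a\<in>UNIV. \<Sum>m\<in>UNIV. Y m a)"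
    by (rule sum.swap)
  also have "\<dots> = - (\<Sum>a\<in>UNIV. \<Sum>m\<in>UNIV. Y a m)"
    by (subst assms) (simp add: sum_negf)
  finally show ?thesis by simp
qed

lemma contract4_add:
  "contract4 (\<lambda>a b m n p. T a b m n p + U a b m n p) p h = contract4 T p h + contract4 U p h"
  by (simp add: contract4_def algebra_simps sum.distrib)

lemma contract4_diff:
  "contract4 (\<lambda>a b m n p. T a b m n p - U a b m n p) p h = contract4 T p h - contract4 U p h"
  by (simp add: contract4_def algebra_simps sum_subtractf)

lemma contract4_antisymmetric_unbarred:
  assumes "\<And>a b m n. T m b a n p = - T a b m n p"
  shows "contract4 T p h = 0"
proof -
  define Y where "Y a m = (\<Sum>b\<in>UNIV. \<Sum>n\<in>UNIV. T a b m n p * h a * cnj (h b) * h m * cnj (h n))" for a m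
  have "Y m a = - Y a m" for a m
    unfolding Y_def sum_negf[symmetric]
    by (intro sum.cong refl) (subst assms, simp)
  then have "(\<Sum>a\<in>UNIV. \<Sum>m\<in>UNIV. Y a m) = 0" by (rule sum_antisymmetric_eq_0)
  moreover have "contract4 T p h = (\<Sum>a\<in>UNIV. \<Sum>m\<in>UNIV. Y a m)"
    unfolding contract4_def Y_def by (rule sum.cong[OF refl], rule sum.swap)
  ultimately show ?thesis by simp
qed

lemma contract4_antisymmetric_barred:
  assumes "\<And>a b m n. T a n m b p = - T a b m n p"
  shows "contract4 T p h = 0"
proof -
  define Y where "Y b n = (\<Sum>a\<in>UNIV. \<Sum>m\<in>UNIV. T a b m n p * h a * cnj (h b) * h m * cnj (h n))" for b n
  have "Y n b = - Y b n" for b n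
    unfolding Y_def sum_negf[symmetric]
    by (intro sum.cong refl) (subst assms, simp)
  then have 0: "(\<Sum>b\<in>UNIV. \<Sum>n\<in>UNIV. Y b n) = 0" by (rule sum_antisymmetric_eq_0)
  have "contract4 T p h = (\<Sum>b\<in>UNIV. \<Sum>a\<in>UNIV. \<Sum>m\<in>UNIV. \<Sum>n\<in>UNIV. T a b m n p * h a * cnj (h b) * h m * cnj (h n))"
    unfolding contract4_def by (rule sum.swap)
  also have "\<dots> = (\<Sum>b\<in>UNIV. \<Sum>n\<in>UNIV. Y b n)"
    unfolding Y_def
  proof (rule sum.cong[OF refl])
    fix b :: 'a
    have "(\<Sum>a\<in>UNIV. \<Sum>m\<in>UNIV. \<Sum>n\<in>UNIV. T a b m n p * h a * cnj (h b) * h m * cnj (h n))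
        = (\<Sum>a\<in>UNIV. \<Sum>n\<in>UNIV. \<Sum>m\<in>UNIV. T a b m n p * h a * cnj (h b) * h m * cnj (h n))"
      by (rule sum.cong[OF refl], rule sum.swap)
    also have "\<dots> = (\<Sum>n\<in>UNIV. \<Sum>a\<in>UNIV. \<Sum>m\<in>UNIV. T a b m n p * h a * cnj (h b) * h m * cnj (h n))"
      by (rule sum.swap)
    finally show "(\<Sum>a\<in>UNIV. \<Sum>m\<in>UNIV. \<Sum>n\<in>UNIV. T a b m n p * h a * cnj (h b) * h m * cnj (h n))
        = (\<Sum>n\<in>UNIV. \<Sum>a\<in>UNIV. \<Sum>m\<in>UNIV. T a b m n p * h a * cnj (h b) * h m * cnj (h n))" .
  qed
  finally show ?thesis using 0 by simp
qed

text \<open>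
  Filling all slots with one vector makes the product of two tensors factor, up to the index \<open>d\<close>
  that links them.
\<close>

lemma contract4_tensor_product:
  "contract4 (\<lambda>a b m n p. \<Sum>d\<in>UNIV. t d m b p * l d a n p) p h =
   (\<Sum>d\<in>UNIV. (\<Sum>m\<in>UNIV. \<Sum>b\<in>UNIV. t d m b p * h m * cnj (h b))
            * (\<Sum>a\<in>UNIV. \<Sum>n\<in>UNIV. l d a n p * h a * cnj (h n)))"
proof -
  define u where "u d m b = t d m b p * h m * cnj (h b)" for d m b
  define w where "w d a n = l d a n p * h a * cnj (h n)" for d a n
  have "contract4 (\<lambda>a b m n p. \<Sum>d\<in>UNIV. t d m b p * l d a n p) p h
      = (\<Sum>a\<in>UNIV. \<Sum>b\<in>UNIV. \<Sum>m\<in>UNIV. \<Sum>n\<in>UNIV. \<Sum>d\<in>UNIV. u d m b * w d a n)"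
    unfolding contract4_def u_def w_def sum_distrib_right
    by (intro sum.cong refl) (simp add: algebra_simps)
  also have "\<dots> = (\<Sum>a\<in>UNIV. \<Sum>b\<in>UNIV. \<Sum>m\<in>UNIV. \<Sum>d\<in>UNIV. \<Sum>n\<in>UNIV. u d m b * w d a n)"
    by (rule sum.cong[OF refl], rule sum.cong[OF refl], rule sum.cong[OF refl], rule sum.swap)
  also have "\<dots> = (\<Sum>a\<in>UNIV. \<Sum>b\<in>UNIV. \<Sum>d\<in>UNIV. \<Sum>m\<in>UNIV. \<Sum>n\<in>UNIV. u d m b * w d a n)"
    by (rule sum.cong[OF refl], rule sum.cong[OF refl], rule sum.swap)
  also have "\<dots> = (\<Sum>a\<in>UNIV. \<Sum>d\<in>UNIV. \<Sum>b\<in>UNIV. \<Sum>m\<in>UNIV. \<Sum>n\<in>UNIV. u d m b * w d a n)"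
    by (rule sum.cong[OF refl], rule sum.swap)
  also have "\<dots> = (\<Sum>d\<in>UNIV. \<Sum>a\<in>UNIV. \<Sum>b\<in>UNIV. \<Sum>m\<in>UNIV. \<Sum>n\<in>UNIV. u d m b * w d a n)"
    by (rule sum.swap)
  also have "\<dots> = (\<Sum>d\<in>UNIV. (\<Sum>b\<in>UNIV. \<Sum>m\<in>UNIV. u d m b) * (\<Sum>a\<in>UNIV. \<Sum>n\<in>UNIV. w d a n))"
    by (simp only: sum_distrib_left[symmetric] sum_distrib_right[symmetric])
  also have "\<dots> = (\<Sum>d\<in>UNIV. (\<Sum>m\<in>UNIV. \<Sum>b\<in>UNIV. u d m b) * (\<Sum>a\<in>UNIV. \<Sum>n\<in>UNIV. w d a n))"
    by (rule sum.cong[OF refl], rule arg_cong2[where f = "(*)"], rule sum.swap, rule refl)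
  finally show ?thesis unfolding u_def w_def .
qed

section \<open>Local theory of a strongly pseudoconvex complex Finsler metric\<close>

text \<open>
  The coordinate expression \<open>G = F\<^sup>2\<close> on the part \<open>S\<close> of the slit tangent bundle over one chart.
  Identities between functions are only available at points of \<open>S\<close>; since \<open>S\<close> is open, they may
  still be differentiated.
\<close>

locale finsler_domain =
  fixes G :: "'n::finite point \<Rightarrow> complex" and S :: "'n point set"
  assumes open_S: "open S"
    and smooth_G: "smooth_on G S"
    and real_G: "\<And>p. p \<in> S \<Longrightarrow> cnj (G p) = G p"
    and G_nonzero: "\<And>p. p \<in> S \<Longrightarrow> G p \<noteq> 0"
    and homogeneous: "\<And>z v \<zeta>. (z, v) \<in> S \<Longrightarrow> \<zeta> \<noteq> 0 \<Longrightarrow> G (z, \<zeta> *s v) = of_real ((cmod \<zeta>)\<^sup>2) * G (z, v)"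
    and levi: "\<And>p. p \<in> S \<Longrightarrow> levi_positive_definite G p"
begin

lemma smooth_G2: "smooth_on (G2 G a b) S"
  unfolding G2_def by (intro smooth_on_pd open_S smooth_G)

text \<open>
  A kernel vector \<open>x\<close> would be isotropic for the Levi form after conjugation: the matrix acts on the
  barred index, so the Levi form has to be evaluated at the conjugate of \<open>x\<close>.
\<close>

lemma invertible_levi:
  assumes "p \<in> S" shows "invertible (\<chi> \<alpha> \<beta>. G2 G \<alpha> \<beta> p)"
proof -
  have "x = 0" if x: "(\<chi> \<alpha> \<beta>. G2 G \<alpha> \<beta> p) *v x = 0" for x
  proof (rule ccontr)
    assume "x \<noteq> 0"
    define w where "w = (\<chi> a. cnj (x $ a))"
    have w: "w \<noteq> 0" using \<open>x \<noteq> 0\<close> by (simp add: vec_eq_iff w_def)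
    have 0: "(\<Sum>b\<in>UNIV. G2 G a b p * x $ b) = 0" for a
      using x by (simp add: vec_eq_iff matrix_vector_mult_def)
    have "(\<Sum>b\<in>UNIV. G2 G a b p * w $ a * cnj (w $ b)) = w $ a * (\<Sum>b\<in>UNIV. G2 G a b p * x $ b)" for a
      unfolding sum_distrib_left by (rule sum.cong) (simp_all add: w_def)
    then have "(\<Sum>a\<in>UNIV. \<Sum>b\<in>UNIV. G2 G a b p * w $ a * cnj (w $ b)) = 0"
      by (simp add: 0)
    then show False
      using levi[OF assms, unfolded levi_positive_definite_def, rule_format, OF w] by simp
  qed
  then show ?thesis
    unfolding invertible_left_inverse matrix_left_invertible_ker by (intro allI impI)
qed

lemma lower_raise:
  assumes "p \<in> S"
  shows "(\<Sum>a\<in>UNIV. G2 G a b p * (\<Sum>l\<in>UNIV. Ginv G l a p * y l)) = y b"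
proof -
  have "(matrix_inv (\<chi> \<alpha> \<beta>. G2 G \<alpha> \<beta> p) ** (\<chi> \<alpha> \<beta>. G2 G \<alpha> \<beta> p)) $ l $ b = mat 1 $ l $ b" for l
    by (simp add: matrix_inv_left_right[OF invertible_levi[OF assms]])
  then have *: "(\<Sum>a\<in>UNIV. Ginv G l a p * G2 G a b p) = (if l = b then 1 else 0)" for l
    by (simp add: matrix_matrix_mult_def Ginv_def mat_def)
  have "(\<Sum>a\<in>UNIV. G2 G a b p * (\<Sum>l\<in>UNIV. Ginv G l a p * y l))
      = (\<Sum>a\<in>UNIV. \<Sum>l\<in>UNIV. Ginv G l a p * G2 G a b p * y l)"
    by (simp add: sum_distrib_left mult_ac)
  also have "\<dots> = (\<Sum>l\<in>UNIV. (\<Sum>a\<in>UNIV. Ginv G l a p * G2 G a b p) * y l)"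
    by (subst sum.swap) (simp add: sum_distrib_right)
  also have "\<dots> = y b" by (simp add: * if_distrib[of "\<lambda>x. x * _"] cong: if_cong)
  finally show ?thesis .
qed

lemma raise_lower:
  assumes "p \<in> S"
  shows "(\<Sum>l\<in>UNIV. Ginv G l a p * (\<Sum>c\<in>UNIV. G2 G c l p * x c)) = x a"
proof -
  have "((\<chi> \<alpha> \<beta>. G2 G \<alpha> \<beta> p) ** matrix_inv (\<chi> \<alpha> \<beta>. G2 G \<alpha> \<beta> p)) $ c $ a = mat 1 $ c $ a" for c
    by (simp add: matrix_inv_left_right[OF invertible_levi[OF assms]])
  then have *: "(\<Sum>l\<in>UNIV. G2 G c l p * Ginv G l a p) = (if c = a then 1 else 0)" for c
    by (simp add: matrix_matrix_mult_def Ginv_def mat_def)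
  have "(\<Sum>l\<in>UNIV. Ginv G l a p * (\<Sum>c\<in>UNIV. G2 G c l p * x c))
      = (\<Sum>l\<in>UNIV. \<Sum>c\<in>UNIV. G2 G c l p * Ginv G l a p * x c)"
    by (simp add: sum_distrib_left mult_ac)
  also have "\<dots> = (\<Sum>c\<in>UNIV. (\<Sum>l\<in>UNIV. G2 G c l p * Ginv G l a p) * x c)"
    by (subst sum.swap) (simp add: sum_distrib_right)
  also have "\<dots> = x a" by (simp add: * if_distrib[of "\<lambda>x. x * _"] cong: if_cong)
  finally show ?thesis .
qed

lemma lower_injective:
  assumes "p \<in> S" "\<And>l. (\<Sum>c\<in>UNIV. G2 G c l p * x c) = (\<Sum>c\<in>UNIV. G2 G c l p * y c)"
  shows "x a = y a"
  using raise_lower[OF assms(1), of a x] raise_lower[OF assms(1), of a y] by (simp add: assms(2))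

lemma smooth_Ginv: "smooth_on (Ginv G l a) S"
proof -
  have "smooth_on (\<lambda>p. matrix_inv (\<chi> \<alpha> \<beta>. G2 G \<alpha> \<beta> p) $ l $ a) S"
    by (rule smooth_on_matrix_inv[OF open_S]) (simp_all add: smooth_G2 invertible_levi)
  then show ?thesis by (simp add: Ginv_def[abs_def])
qed

lemma smooth_Gam1: "smooth_on (Gam1 G a m) S"
proof -
  have "smooth_on (\<lambda>p. Gam1 G a m p) S"
    unfolding Gam1_def by (intro smooth_on_sum smooth_on_mult smooth_on_pd open_S smooth_G smooth_Ginv)
  then show ?thesis by simp
qed

lemma smooth_delta: "smooth_on (delta G m k) S"
proof -
  have "smooth_on (\<lambda>p. delta G m k p) S"
    by (cases k) (simp_all add: delta_def smooth_on_minus open_S smooth_Gam1)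
  then show ?thesis by simp
qed

lemma smooth_deltab: "smooth_on (deltab G m k) S"
proof -
  have "smooth_on (\<lambda>p. deltab G m k p) S"
    unfolding deltab_def vf_conj_def by (intro smooth_on_cnj open_S smooth_delta)
  then show ?thesis by simp
qed

lemma smooth_delta_G2: "smooth_on (vf_apply (delta G m) (G2 G a b)) S"
  by (intro smooth_on_vf_apply open_S smooth_delta smooth_G2)

lemma smooth_deltab_G2: "smooth_on (vf_apply (deltab G m) (G2 G a b)) S"
  by (intro smooth_on_vf_apply open_S smooth_deltab smooth_G2)

lemma smooth_Gam2: "smooth_on (Gam2 G a b m) S"
proof -
  have "smooth_on (\<lambda>p. Gam2 G a b m p) S"
    unfolding Gam2_def by (intro smooth_on_sum smooth_on_mult open_S smooth_Ginv smooth_delta_G2)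
  then show ?thesis by simp
qed

lemma smooth_L1: "smooth_on (L1 G a b m) S"
proof -
  have "smooth_on (\<lambda>p. L1 G a b m p) S"
    unfolding L1_def
    by (intro smooth_on_sum smooth_on_mult smooth_on_add smooth_on_const open_S smooth_Ginv smooth_delta_G2)
  then show ?thesis by simp
qed

lemma smooth_L1b: "smooth_on (L1b G a b m) S"
proof -
  have "smooth_on (\<lambda>p. L1b G a b m p) S"
    unfolding L1b_def
    by (intro smooth_on_sum smooth_on_mult smooth_on_diff smooth_on_const open_S smooth_Ginv smooth_deltab_G2)
  then show ?thesis by simp
qed

lemma pd_cnj_G: "p \<in> S \<Longrightarrow> cnj (pd i G p) = pd (conj_idx i) G p"
proof -
  assume p: "p \<in> S"
  have d: "G differentiable (at p)" using smooth_on_differentiable[OF smooth_G p] .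
  have ii: "conj_idx (conj_idx i) = i" by (cases i) auto
  have "cnj (pd i G p) = pd (conj_idx i) (\<lambda>p. cnj (G p)) p"
    by (simp add: pd_cnj[OF d] ii)
  also have "\<dots> = pd (conj_idx i) G p"
    by (rule pd_cong[OF open_S p real_G smooth_on_differentiable[OF smooth_on_cnj[OF open_S smooth_G] p]])
  finally show ?thesis .
qed

lemma G2_hermitian: "p \<in> S \<Longrightarrow> cnj (G2 G a b p) = G2 G b a p"
proof -
  assume p: "p \<in> S"
  have sm: "smooth_on (pd (V a) G) S" by (intro smooth_on_pd open_S smooth_G)
  have "cnj (G2 G a b p) = pd (V b) (\<lambda>x. cnj (pd (V a) G x)) p"
    unfolding G2_def using pd_cnj[OF smooth_on_differentiable[OF sm p], of "V b"] by simp
  also have "\<dots> = pd (V b) (pd (Vb a) G) p"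
    by (rule pd_cong[OF open_S p _ smooth_on_differentiable[OF smooth_on_cnj[OF open_S sm] p]])
       (simp add: pd_cnj_G)
  also have "\<dots> = G2 G b a p"
    unfolding G2_def by (rule pd_commute[OF open_S p smooth_G])
  finally show ?thesis .
qed

lemma deltab_G2: "p \<in> S \<Longrightarrow> vf_apply (deltab G m) (G2 G a b) p = cnj (vf_apply (delta G m) (G2 G b a) p)"
proof -
  assume p: "p \<in> S"
  have "vf_apply (deltab G m) (G2 G a b) p = vf_apply (deltab G m) (\<lambda>x. cnj (G2 G b a x)) p"
    by (rule vf_apply_cong[OF open_S p _ smooth_on_differentiable[OF smooth_G2 p]])
       (simp add: G2_hermitian)
  also have "\<dots> = cnj (vf_apply (delta G m) (G2 G b a) p)"
    unfolding deltab_def by (rule vf_apply_conj[OF smooth_on_differentiable[OF smooth_G2 p]])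
  finally show ?thesis .
qed

subsection \<open>Homogeneity\<close>

text \<open>
  The two cases of interest are \<open>c = 1\<close> and \<open>c = \<i>\<close>. Homogeneity gives
  \<open>G (z, v + t c v) = \<bar>1 + t c\<bar>\<^sup>2 G (z, v)\<close> for small \<open>t\<close>, whose derivative at \<open>t = 0\<close> is
  \<open>2 Re c G\<close>.
\<close>

lemma derivative_along_fibre:
  assumes p: "(z, v) \<in> S" and c: "cmod c = 1"
  shows "frechet_derivative G (at (z, v)) (0, c *s v) = 2 * Re c * G (z, v)"
proof -
  define D where "D = frechet_derivative G (at (z, v))"
  have D: "(G has_derivative D) (at (z, v))"
    unfolding D_def by (rule smooth_on_has_derivative[OF smooth_G p])
  define \<gamma> where "\<gamma> t = (z, v + t *\<^sub>R (c *s v))" for t :: real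
  have \<gamma>: "(\<gamma> has_derivative (\<lambda>t. (0, t *\<^sub>R (c *s v)))) (at 0)"
    unfolding \<gamma>_def by (auto intro!: derivative_eq_intros)
  have "(G has_derivative D) (at (\<gamma> 0))" using D by (simp add: \<gamma>_def)
  from has_derivative_compose[OF \<gamma> this]
  have "((\<lambda>t. G (\<gamma> t)) has_derivative (\<lambda>t. D (0, t *\<^sub>R (c *s v)))) (at 0)" .
  moreover have "D (0, t *\<^sub>R (c *s v)) = t *\<^sub>R D (0, c *s v)" for t
    using linear_cmul[OF has_derivative_linear[OF D], of t "(0, c *s v)"] by simp
  ultimately have 1: "((\<lambda>t. G (\<gamma> t)) has_vector_derivative D (0, c *s v)) (at 0)"
    by (simp add: has_vector_derivative_def)
  have "((\<lambda>t::real. of_real ((1 + t * Re c)\<^sup>2 + (t * Im c)\<^sup>2) * G (z, v)) has_vector_derivative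
       of_real (2 * Re c) * G (z, v)) (at 0)"
  proof (rule bounded_linear.has_vector_derivative
      [OF bounded_linear_compose[OF bounded_linear_mult_left bounded_linear_of_real]])
    have "((\<lambda>t::real. (1 + t * Re c)\<^sup>2 + (t * Im c)\<^sup>2) has_real_derivative 2 * Re c) (at 0)"
      by (auto intro!: derivative_eq_intros)
    then show "((\<lambda>t::real. (1 + t * Re c)\<^sup>2 + (t * Im c)\<^sup>2) has_vector_derivative 2 * Re c) (at 0)"
      by (simp add: has_real_derivative_iff_has_vector_derivative)
  qed
  then have 2: "((\<lambda>t. G (\<gamma> t)) has_vector_derivative of_real (2 * Re c) * G (z, v)) (at 0)"
  proof (rule has_vector_derivative_transform_within_open[of _ _ _ "{-1<..<1}"])
    \<comment> \<open>The range of \<open>t\<close> keeps the scaling factor \<open>1 + t c\<close> away from \<open>0\<close>.\<close>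
    fix t :: real assume t: "t \<in> {-1<..<1}"
    have "cmod (of_real t * c) < 1" using t c by (simp add: norm_mult abs_less_iff)
    then have "1 + of_real t * c \<noteq> 0" by (metis add_eq_0_iff norm_minus_cancel norm_one less_irrefl)
    moreover have "\<gamma> t = (z, (1 + of_real t * c) *s v)"
      by (simp add: \<gamma>_def vec_eq_iff algebra_simps scaleR_conv_of_real[where 'a = complex])
    ultimately have "G (\<gamma> t) = of_real ((cmod (1 + of_real t * c))\<^sup>2) * G (z, v)"
      using homogeneous[OF p] by (simp only:)
    then show "of_real ((1 + t * Re c)\<^sup>2 + (t * Im c)\<^sup>2) * G (z, v) = G (\<gamma> t)"
      by (simp add: cmod_power2)
  qed auto
  show ?thesis using vector_derivative_unique_at[OF 1 2] by (simp add: D_def)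
qed

text \<open>
  The other relations of this part come from this one by conjugation and differentiation: each
  derivative of
  \<open>v\<^sup>b f\<^sub>b\<close> reproduces \<open>v\<^sup>b \<partial>f\<^sub>b\<close>, with an additional \<open>f\<^sub>a\<close> only for \<open>\<partial>/\<partial>v\<^sup>a\<close>.
\<close>

lemma euler:
  assumes "p \<in> S"
  shows "(\<Sum>b\<in>UNIV. snd p $ b * pd (V b) G p) = G p"
proof -
  obtain z v where p: "p = (z, v)" by fastforce
  have "linear (frechet_derivative G (at p))"
    using smooth_on_has_derivative[OF smooth_G assms] has_derivative_linear by blast
  from linear_complexify_fibre[OF this, of v]
  have "(\<Sum>b\<in>UNIV. snd p $ b * pd (V b) G p)
      = (frechet_derivative G (at p) (0, v) - \<i> * frechet_derivative G (at p) (0, \<i> *s v)) / 2"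
    by (simp add: p pd.simps)
  then show ?thesis
    using derivative_along_fibre[of z v 1] derivative_along_fibre[of z v \<i>] assms by (simp add: p)
qed

lemma pd_radial_sum:
  assumes p: "p \<in> S" and f: "\<And>b. smooth_on (f b) S"
  shows "pd i (\<lambda>p. \<Sum>b\<in>UNIV. snd p $ b * f b p) p
    = (\<Sum>b\<in>UNIV. if i = V b then f b p else 0) + (\<Sum>b\<in>UNIV. snd p $ b * pd i (f b) p)"
proof -
  note d = smooth_on_differentiable[OF _ p]
  have c: "smooth_on (\<lambda>p::'n point. snd p $ b) S" for b
    by (rule smooth_on_fibre_coordinate[OF open_S])
  have "pd i (\<lambda>p. \<Sum>b\<in>UNIV. snd p $ b * f b p) p = (\<Sum>b\<in>UNIV. pd i (\<lambda>p. snd p $ b * f b p) p)"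
    by (rule pd_sum) (rule d[OF smooth_on_mult[OF open_S c f]])
  also have "\<dots> = (\<Sum>b\<in>UNIV. (if i = V b then f b p else 0) + snd p $ b * pd i (f b) p)"
    by (intro sum.cong refl) (simp add: pd_mult[OF d[OF c] d[OF f]] pd_fibre_coordinate)
  finally show ?thesis by (simp add: sum.distrib)
qed

lemma euler_G2:
  assumes p: "p \<in> S"
  shows "(\<Sum>b\<in>UNIV. snd p $ b * G2 G b l p) = pd (Vb l) G p"
proof -
  have sm: "smooth_on (pd (V b) G) S" for b by (intro smooth_on_pd open_S smooth_G)
  have "pd (Vb l) (\<lambda>p. \<Sum>b\<in>UNIV. snd p $ b * pd (V b) G p) p = pd (Vb l) G p"
    by (rule pd_cong[OF open_S p], rule euler, assumption)
       (intro smooth_on_differentiable[OF _ p] smooth_on_sum smooth_on_mult smooth_on_fibre_coordinate open_S sm)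
  then show ?thesis by (simp add: pd_radial_sum[OF p sm] G2_def)
qed

lemma euler_G1:
  assumes p: "p \<in> S"
  shows "(\<Sum>b\<in>UNIV. G2 G a b p * cnj (snd p $ b)) = G1 G a p"
proof -
  have "cnj (\<Sum>b\<in>UNIV. snd p $ b * G2 G b a p) = cnj (pd (Vb a) G p)"
    by (simp only: euler_G2[OF p])
  then show ?thesis by (simp add: G2_hermitian[OF p] pd_cnj_G[OF p] G1_def mult.commute)
qed

lemma euler_pd_G2:
  assumes p: "p \<in> S"
  shows "(\<Sum>b\<in>UNIV. if i = V b then G2 G b l p else 0) + (\<Sum>b\<in>UNIV. snd p $ b * pd i (G2 G b l) p)
    = pd i (pd (Vb l) G) p"
proof -
  have "pd i (\<lambda>p. \<Sum>b\<in>UNIV. snd p $ b * G2 G b l p) p = pd i (pd (Vb l) G) p"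
    by (rule pd_cong[OF open_S p], rule euler_G2, assumption)
       (intro smooth_on_differentiable[OF _ p] smooth_on_sum smooth_on_mult smooth_on_fibre_coordinate open_S smooth_G2)
  then show ?thesis by (simp add: pd_radial_sum[OF p smooth_G2])
qed

text \<open>
  For \<open>i = V a\<close> the additional term \<open>G\<^bsub>a l\<^esub>\<close> of \<open>euler_pd_G2\<close> already equals the right-hand side.
  This says that the Levi matrix is homogeneous of degree \<open>0\<close> in \<open>v\<close>.
\<close>

lemma euler_pd_V_G2:
  assumes p: "p \<in> S"
  shows "(\<Sum>b\<in>UNIV. snd p $ b * pd (V a) (G2 G b l) p) = 0"
  using euler_pd_G2[OF p, of "V a" l] pd_commute[OF open_S p smooth_G, of "V a" "Vb l"]
  by (simp add: G2_def)

lemma euler_pd_Z_G2: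
  assumes p: "p \<in> S"
  shows "(\<Sum>b\<in>UNIV. snd p $ b * pd (Z m) (G2 G b l) p) = pd (Vb l) (pd (Z m) G) p"
  using euler_pd_G2[OF p, of "Z m" l] pd_commute[OF open_S p smooth_G, of "Z m" "Vb l"] by simp

lemma pd_G2:
  assumes p: "p \<in> S"
  shows "pd i (G2 G b l) p = pd (V b) (pd (Vb l) (pd i G)) p"
proof -
  have sm: "smooth_on (pd j G) S" for j by (intro smooth_on_pd open_S smooth_G)
  have sm2: "smooth_on (pd k (pd j G)) S" for j k by (intro smooth_on_pd open_S smooth_G)
  note d = smooth_on_differentiable[OF _ p]
  have "pd i (G2 G b l) p = pd i (pd (V b) (pd (Vb l) G)) p"
    unfolding G2_def
    by (rule pd_cong[OF open_S p pd_commute[OF open_S _ smooth_G] d[OF sm2]])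
  also have "\<dots> = pd (V b) (pd i (pd (Vb l) G)) p"
    by (rule pd_commute[OF open_S p sm])
  also have "\<dots> = pd (V b) (pd (Vb l) (pd i G)) p"
    by (rule pd_cong[OF open_S p pd_commute[OF open_S _ smooth_G] d[OF sm2]])
  finally show ?thesis .
qed

lemma pd_V_G2_symmetric:
  assumes p: "p \<in> S"
  shows "pd (V a) (G2 G b l) p = pd (V b) (G2 G a l) p"
proof -
  have "pd (V a) (G2 G b l) p = pd (V b) (pd (Vb l) (pd (V a) G)) p"
    by (rule pd_G2[OF p])
  then show ?thesis by (simp add: G2_def)
qed

subsection \<open>Nonlinear connection\<close>

lemma vf_apply_delta:
  "vf_apply (delta G m) f p = pd (Z m) f p - (\<Sum>a\<in>UNIV. Gam1 G a m p * pd (V a) f p)"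
  by (simp add: vf_apply_def delta_def sum.distrib sum_subtractf sum_negf if_distrib[of "\<lambda>x. x * _"] cong: if_cong)

lemma lower_Gam1:
  assumes "p \<in> S"
  shows "(\<Sum>a\<in>UNIV. G2 G a l p * Gam1 G a m p) = pd (Vb l) (pd (Z m) G) p"
  unfolding Gam1_def by (rule lower_raise[OF assms])

lemma lower_Gam2:
  assumes "p \<in> S"
  shows "(\<Sum>a\<in>UNIV. G2 G a l p * Gam2 G a b m p) = vf_apply (delta G m) (G2 G b l) p"
  unfolding Gam2_def by (rule lower_raise[OF assms])

text \<open>
  Differentiate \<open>lower_Gam1\<close> instead of the definition, which avoids derivatives of the inverse
  matrix. The symmetry of \<open>\<partial>G\<^bsub>a l\<^esub>/\<partial>v\<^sup>b\<close> in \<open>a\<close> and \<open>b\<close> turns the term \<open>\<Gamma>\<^sup>a\<^bsub>;m\<^esub> \<partial>G\<^bsub>a l\<^esub>/\<partial>v\<^sup>b\<close> into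
  the vertical part of \<open>\<delta>\<^sub>m G\<^bsub>b l\<^esub>\<close>.
\<close>

lemma pd_V_Gam1:
  assumes p: "p \<in> S"
  shows "pd (V b) (Gam1 G a m) p = Gam2 G a b m p"
proof (rule lower_injective[OF p, of "\<lambda>a. pd (V b) (Gam1 G a m) p" "\<lambda>a. Gam2 G a b m p"])
  fix l
  note d = smooth_on_differentiable[OF _ p]
  have "pd (V b) (\<lambda>p. \<Sum>a\<in>UNIV. G2 G a l p * Gam1 G a m p) p = pd (V b) (pd (Vb l) (pd (Z m) G)) p"
    by (rule pd_cong[OF open_S p], rule lower_Gam1, assumption)
       (intro d smooth_on_sum smooth_on_mult open_S smooth_G2 smooth_Gam1)
  moreover have "pd (V b) (\<lambda>p. \<Sum>a\<in>UNIV. G2 G a l p * Gam1 G a m p) p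
      = (\<Sum>a\<in>UNIV. pd (V b) (\<lambda>p. G2 G a l p * Gam1 G a m p) p)"
    by (rule pd_sum) (intro d smooth_on_mult open_S smooth_G2 smooth_Gam1)
  moreover have "\<dots> = (\<Sum>a\<in>UNIV. pd (V a) (G2 G b l) p * Gam1 G a m p + G2 G a l p * pd (V b) (Gam1 G a m) p)"
    by (intro sum.cong refl)
       (simp add: pd_mult[OF d[OF smooth_G2] d[OF smooth_Gam1]] pd_V_G2_symmetric[OF p, of b])
  ultimately have "(\<Sum>a\<in>UNIV. G2 G a l p * pd (V b) (Gam1 G a m) p) = vf_apply (delta G m) (G2 G b l) p"
    by (simp add: vf_apply_delta pd_G2[OF p, of "Z m" b l] sum.distrib algebra_simps)
  then show "(\<Sum>a\<in>UNIV. G2 G a l p * pd (V b) (Gam1 G a m) p) = (\<Sum>a\<in>UNIV. G2 G a l p * Gam2 G a b m p)"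
    by (simp add: lower_Gam2[OF p])
qed

text \<open>
  After lowering the index, this is the homogeneity of \<open>\<partial>G/\<partial>z\<^sup>m\<close> in degree \<open>1\<close>; the vertical
  part of \<open>\<delta>\<^sub>m\<close> contributes nothing since the Levi matrix has degree \<open>0\<close>.
\<close>

lemma Gam2_radial:
  assumes p: "p \<in> S"
  shows "(\<Sum>b\<in>UNIV. snd p $ b * Gam2 G a b m p) = Gam1 G a m p"
proof (rule lower_injective[OF p, of "\<lambda>a. \<Sum>b\<in>UNIV. snd p $ b * Gam2 G a b m p" "\<lambda>a. Gam1 G a m p"])
  fix l
  have "(\<Sum>a\<in>UNIV. G2 G a l p * (\<Sum>b\<in>UNIV. snd p $ b * Gam2 G a b m p))
      = (\<Sum>b\<in>UNIV. \<Sum>a\<in>UNIV. snd p $ b * (G2 G a l p * Gam2 G a b m p))"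
    by (subst sum.swap) (simp add: sum_distrib_left algebra_simps)
  also have "\<dots> = (\<Sum>b\<in>UNIV. snd p $ b * vf_apply (delta G m) (G2 G b l) p)"
    by (simp add: lower_Gam2[OF p] flip: sum_distrib_left)
  also have "\<dots> = (\<Sum>b\<in>UNIV. snd p $ b * pd (Z m) (G2 G b l) p)
      - (\<Sum>b\<in>UNIV. \<Sum>a\<in>UNIV. Gam1 G a m p * (snd p $ b * pd (V a) (G2 G b l) p))"
    by (simp add: vf_apply_delta right_diff_distrib sum_subtractf sum_distrib_left algebra_simps)
  also have "(\<Sum>b\<in>UNIV. \<Sum>a\<in>UNIV. Gam1 G a m p * (snd p $ b * pd (V a) (G2 G b l) p)) = 0"
    by (subst sum.swap) (simp add: euler_pd_V_G2[OF p] flip: sum_distrib_left)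
  finally show "(\<Sum>a\<in>UNIV. G2 G a l p * (\<Sum>b\<in>UNIV. snd p $ b * Gam2 G a b m p))
     = (\<Sum>a\<in>UNIV. G2 G a l p * Gam1 G a m p)"
    by (simp add: euler_pd_Z_G2[OF p] lower_Gam1[OF p])
qed

text \<open>
  The theorem of Chen and Shen. By \<open>Gam2_radial\<close> the hypothesis reads
  \<open>\<Gamma>\<^sup>a\<^bsub>;m\<^esub> = v\<^sup>b \<Gamma>\<^sup>a\<^bsub>m;b\<^esub>\<close>. Its derivative along \<open>v\<^sup>c\<close> is
  \<open>\<Gamma>\<^sup>a\<^bsub>c;m\<^esub> - \<Gamma>\<^sup>a\<^bsub>m;c\<^esub> = v\<^sup>b \<partial>\<^sup>2\<Gamma>\<^sup>a\<^bsub>;b\<^esub>/\<partial>v\<^sup>c\<partial>v\<^sup>m\<close>: the left-hand side is antisymmetric and the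
  right-hand side symmetric in \<open>c\<close> and \<open>m\<close>, so both vanish. The hypothesis is needed on all of
  \<open>S\<close> because it is differentiated.
\<close>

lemma kaehler_imp_symmetric:
  assumes K: "\<And>p. p \<in> S \<Longrightarrow> kaehler_at G p" and p: "p \<in> S"
  shows "Gam2 G a c m p = Gam2 G a m c p"
proof -
  note d = smooth_on_differentiable[OF _ p]
  have K': "Gam1 G a m q = (\<Sum>b\<in>UNIV. snd q $ b * Gam2 G a m b q)" if q: "q \<in> S" for m q
    using K[OF q] Gam2_radial[OF q, of a m]
    by (simp add: kaehler_at_def right_diff_distrib sum_subtractf mult.commute)
  have *: "Gam2 G a c m p = Gam2 G a m c p + (\<Sum>b\<in>UNIV. snd p $ b * pd (V c) (pd (V m) (Gam1 G a b)) p)" for c m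
  proof -
    have "Gam2 G a c m p = pd (V c) (Gam1 G a m) p" by (rule pd_V_Gam1[OF p, symmetric])
    also have "\<dots> = pd (V c) (\<lambda>p. \<Sum>b\<in>UNIV. snd p $ b * Gam2 G a m b p) p"
      by (rule pd_cong[OF open_S p K' d[OF smooth_Gam1]])
    also have "\<dots> = Gam2 G a m c p + (\<Sum>b\<in>UNIV. snd p $ b * pd (V c) (Gam2 G a m b) p)"
      by (simp add: pd_radial_sum[OF p smooth_Gam2])
    also have "\<dots> = Gam2 G a m c p + (\<Sum>b\<in>UNIV. snd p $ b * pd (V c) (pd (V m) (Gam1 G a b)) p)"
      by (intro arg_cong2[where f = "(+)"] sum.cong arg_cong2[where f = "(*)"] refl,
          rule pd_cong[OF open_S p pd_V_Gam1[symmetric] d[OF smooth_Gam2]])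
    finally show ?thesis .
  qed
  have "Gam2 G a c m p - Gam2 G a m c p = Gam2 G a m c p - Gam2 G a c m p"
    using *[of c m] *[of m c]
    by (simp add: pd_commute[OF open_S p smooth_Gam1, of "V c" "V m"])
  then show ?thesis by simp
qed

subsection \<open>Torsion and the difference of the two curvature tensors\<close>

text \<open>
  The lowered torsion \<open>T\<^bsub>c m, b\<^esub>\<close> with barred last index, that is
  \<open>G\<^bsub>a b\<^esub> (\<Gamma>\<^sup>a\<^bsub>c;m\<^esub> - \<Gamma>\<^sup>a\<^bsub>m;c\<^esub>) / 2\<close>. In this form it involves no inverse matrix.
\<close>

definition torsion :: "'n \<Rightarrow> 'n \<Rightarrow> 'n \<Rightarrow> 'n point \<Rightarrow> complex" where
  "torsion c m b p = (1/2) * (vf_apply (delta G m) (G2 G c b) p - vf_apply (delta G c) (G2 G m b) p)"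

lemma torsion_antisymmetric: "torsion m c b p = - torsion c m b p"
  by (simp add: torsion_def algebra_simps)

lemma smooth_torsion: "smooth_on (torsion c m b) S"
proof -
  have "smooth_on (\<lambda>p. torsion c m b p) S"
    unfolding torsion_def
    by (intro smooth_on_mult smooth_on_diff smooth_on_const open_S smooth_delta_G2)
  then show ?thesis by simp
qed

lemma lower_Gam2_antisymmetrized:
  assumes p: "p \<in> S"
  shows "(\<Sum>a\<in>UNIV. G2 G a b p * (Gam2 G a c m p - Gam2 G a m c p)) = 2 * torsion c m b p"
  by (simp add: torsion_def right_diff_distrib sum_subtractf lower_Gam2[OF p])

lemma lower_L1:
  assumes p: "p \<in> S"
  shows "(\<Sum>c\<in>UNIV. G2 G c b p * L1 G c d m p) = vf_apply (delta G m) (G2 G d b) p - torsion d m b p"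
proof -
  have "(\<Sum>c\<in>UNIV. G2 G c b p * L1 G c d m p) = (1/2) * (\<Sum>c\<in>UNIV. G2 G c b p *
      (\<Sum>l\<in>UNIV. Ginv G l c p * (vf_apply (delta G m) (G2 G d l) p + vf_apply (delta G d) (G2 G m l) p)))"
    unfolding L1_def sum_distrib_left by (intro sum.cong refl) (simp only: mult_ac)
  also have "\<dots> = (1/2) * (vf_apply (delta G m) (G2 G d b) p + vf_apply (delta G d) (G2 G m b) p)"
    by (simp only: lower_raise[OF p, of b "\<lambda>l. vf_apply (delta G m) (G2 G d l) p + vf_apply (delta G d) (G2 G m l) p"])
  finally show ?thesis by (simp add: torsion_def field_simps)
qed

text \<open>
  The lowered mixed coefficient is \<open>(\<delta>\<^sub>n G\<^bsub>a b\<^esub> - \<delta>\<^sub>b G\<^bsub>a n\<^esub>) / 2\<close> with \<open>\<delta>\<^sub>n\<close> and \<open>\<delta>\<^sub>b\<close> barred; since the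
  Levi matrix is Hermitian this is the conjugate of a torsion component with the roles of barred and
  unbarred indices exchanged.
\<close>

lemma lower_L1b:
  assumes p: "p \<in> S"
  shows "(\<Sum>c\<in>UNIV. G2 G c b p * L1b G c a n p) = cnj (torsion b n a p)"
proof -
  have "(\<Sum>c\<in>UNIV. G2 G c b p * L1b G c a n p) = (1/2) * (\<Sum>c\<in>UNIV. G2 G c b p *
      (\<Sum>l\<in>UNIV. Ginv G l c p * (vf_apply (deltab G n) (G2 G a l) p - vf_apply (deltab G l) (G2 G a n) p)))"
    unfolding L1b_def sum_distrib_left by (intro sum.cong refl) (simp only: mult_ac)
  also have "\<dots> = (1/2) * (vf_apply (deltab G n) (G2 G a b) p - vf_apply (deltab G b) (G2 G a n) p)"
    by (simp only: lower_raise[OF p, of b "\<lambda>l. vf_apply (deltab G n) (G2 G a l) p - vf_apply (deltab G l) (G2 G a n) p"])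
  finally show ?thesis by (simp add: torsion_def deltab_G2[OF p])
qed

lemma omega_delta: "omega G c b (delta G m) p = L1 G c b m p"
proof -
  have v: "delta_v G g (delta G m) p = 0" for g
    by (simp add: delta_v_def delta_def if_distrib[of "\<lambda>x. _ * x"] cong: if_cong)
  show ?thesis
    by (simp add: omega_def v delta_def if_distrib[of "\<lambda>x. _ * x"] cong: if_cong)
qed

lemma omega_deltab: "omega G c b (deltab G n) p = L1b G c b n p"
proof -
  have X: "deltab G n (Z m) p = 0" "deltab G n (V m) p = 0"
    "deltab G n (Zb m) p = (if m = n then 1 else 0)" for m
    by (simp_all add: deltab_def vf_conj_def delta_def)
  show ?thesis
    by (simp add: omega_def delta_v_def X if_distrib[of "\<lambda>x. _ * x"] cong: if_cong)
qed

lemma nabla_frame: "nabla G X (frame_section a) c p = omega G c a X p"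
  by (simp add: nabla_def frame_section_def[abs_def] if_distrib[of "\<lambda>x. _ * x"] cong: if_cong)

text \<open>
  The bracket of \<open>\<delta>\<^sub>m\<close> and the conjugate of \<open>\<delta>\<^sub>n\<close> is vertical; its components along
  \<open>\<partial>/\<partial>v\<^sup>b\<close> are the derivatives of \<open>\<Gamma>\<^sup>b\<^bsub>;m\<^esub>\<close>, and those along the conjugate directions are not
  seen by the connection forms.
\<close>

lemma omega_bracket:
  assumes p: "p \<in> S"
  shows "omega G c a (vf_bracket (delta G m) (deltab G n)) p
    = (\<Sum>g\<in>UNIV. Gamv G c a g p * vf_apply (deltab G n) (Gam1 G g m) p)"
proof -
  have c: "delta G m (Z b) = (\<lambda>p. if b = m then 1 else 0)" "delta G m (Zb b) = (\<lambda>p. 0)"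
    "delta G m (V b) = (\<lambda>p. - Gam1 G b m p)"
    "deltab G n (Zb b) = (\<lambda>p. if b = n then 1 else 0)" "deltab G n (Z b) = (\<lambda>p. 0)" "deltab G n (V b) = (\<lambda>p. 0)" for b
    by (simp_all add: fun_eq_iff delta_def deltab_def vf_conj_def)
  have B: "vf_bracket (delta G m) (deltab G n) (Z b) p = 0"
    "vf_bracket (delta G m) (deltab G n) (Zb b) p = 0"
    "vf_bracket (delta G m) (deltab G n) (V b) p = vf_apply (deltab G n) (Gam1 G b m) p" for b
    by (simp_all add: vf_bracket_def c vf_apply_minus[OF smooth_on_differentiable[OF smooth_Gam1 p]])
  show ?thesis by (simp add: omega_def delta_v_def B)
qed

lemma curv_nabla_eq:
  assumes p: "p \<in> S"
  shows "curv_nabla G a b m n p = (\<Sum>c\<in>UNIV. G2 G c b p *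
    (vf_apply (delta G m) (L1b G c a n) p + (\<Sum>d\<in>UNIV. L1 G c d m p * L1b G d a n p)
     - (vf_apply (deltab G n) (L1 G c a m) p + (\<Sum>d\<in>UNIV. L1b G c d n p * L1 G d a m p))
     - (\<Sum>g\<in>UNIV. Gamv G c a g p * vf_apply (deltab G n) (Gam1 G g m) p)))"
proof -
  have f: "nabla G (deltab G n) (frame_section a) = (\<lambda>c. L1b G c a n)"
    "nabla G (delta G m) (frame_section a) = (\<lambda>c. L1 G c a m)"
    by (simp_all add: fun_eq_iff nabla_frame omega_delta omega_deltab)
  have h: "hermitian_product G H (frame_section b) p = (\<Sum>c\<in>UNIV. G2 G c b p * H c p)" for H
    by (simp add: hermitian_product_def frame_section_def if_distrib[of "\<lambda>x. _ * x"] if_distrib[of cnj] cong: if_cong)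
  show ?thesis
    unfolding curv_nabla_def h f nabla_frame omega_bracket[OF p]
    by (simp add: nabla_def omega_delta omega_deltab)
qed

lemma delta_lower_L1b:
  assumes p: "p \<in> S"
  shows "(\<Sum>c\<in>UNIV. G2 G c b p * vf_apply (delta G m) (L1b G c a n) p)
    = vf_apply (delta G m) (\<lambda>p. cnj (torsion b n a p)) p
      - (\<Sum>c\<in>UNIV. vf_apply (delta G m) (G2 G c b) p * L1b G c a n p)"
proof -
  note d = smooth_on_differentiable[OF _ p]
  have "vf_apply (delta G m) (\<lambda>p. \<Sum>c\<in>UNIV. G2 G c b p * L1b G c a n p) p
      = vf_apply (delta G m) (\<lambda>p. cnj (torsion b n a p)) p"
    by (rule vf_apply_cong[OF open_S p], rule lower_L1b, assumption)
       (intro d smooth_on_sum smooth_on_mult open_S smooth_G2 smooth_L1b)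
  moreover have "vf_apply (delta G m) (\<lambda>p. \<Sum>c\<in>UNIV. G2 G c b p * L1b G c a n p) p
      = (\<Sum>c\<in>UNIV. vf_apply (delta G m) (\<lambda>p. G2 G c b p * L1b G c a n p) p)"
    by (rule vf_apply_sum) (intro d smooth_on_mult open_S smooth_G2 smooth_L1b)
  ultimately show ?thesis
    by (simp add: vf_apply_mult[OF d[OF smooth_G2] d[OF smooth_L1b]] sum.distrib algebra_simps)
qed

text \<open>
  The terms with \<open>\<Gamma>\<^sup>c\<^bsub>a g\<^esub>\<close> are common to both tensors. The derivative of the Levi matrix produced by
  the Leibniz rule cancels against that in \<open>lower_L1\<close>, leaving a product of the torsion with the
  mixed coefficients. On the right, the first two terms are antisymmetric in \<open>b, n\<close> and the third in
  \<open>a, m\<close>.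
\<close>

lemma curvature_difference:
  assumes p: "p \<in> S"
  shows "curv_nabla G a b m n p - curv_D G a b m n p =
      vf_apply (delta G m) (\<lambda>p. cnj (torsion b n a p)) p
    - (\<Sum>d\<in>UNIV. cnj (torsion b n d p) * L1 G d a m p)
    + (\<Sum>c\<in>UNIV. G2 G c b p * vf_apply (deltab G n) (\<lambda>p. Gam2 G c a m p - L1 G c a m p) p)
    - (\<Sum>d\<in>UNIV. torsion d m b p * L1b G d a n p)"
proof -
  note d = smooth_on_differentiable[OF _ p]
  have swap: "(\<Sum>c\<in>UNIV. G2 G c b p * (\<Sum>d\<in>UNIV. x c d * y d))
      = (\<Sum>d\<in>UNIV. (\<Sum>c\<in>UNIV. G2 G c b p * x c d) * y d)" for x :: "'n \<Rightarrow> 'n \<Rightarrow> complex" and y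
    unfolding sum_distrib_left sum_distrib_right by (subst sum.swap) (simp add: mult_ac)
  have "curv_nabla G a b m n p - curv_D G a b m n p
    = (\<Sum>c\<in>UNIV. G2 G c b p * vf_apply (delta G m) (L1b G c a n) p)
    + (\<Sum>c\<in>UNIV. G2 G c b p * (\<Sum>d\<in>UNIV. L1 G c d m p * L1b G d a n p))
    - (\<Sum>c\<in>UNIV. G2 G c b p * (\<Sum>d\<in>UNIV. L1b G c d n p * L1 G d a m p))
    + (\<Sum>c\<in>UNIV. G2 G c b p * vf_apply (deltab G n) (\<lambda>p. Gam2 G c a m p - L1 G c a m p) p)"
    unfolding curv_nabla_eq[OF p] curv_D_def Omega_up_def
      vf_apply_diff[OF d[OF smooth_Gam2] d[OF smooth_L1]]
      sum_subtractf[symmetric] sum.distrib[symmetric]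
    by (rule sum.cong) (simp_all add: algebra_simps)
  also have "(\<Sum>c\<in>UNIV. G2 G c b p * (\<Sum>d\<in>UNIV. L1 G c d m p * L1b G d a n p))
     = (\<Sum>d\<in>UNIV. vf_apply (delta G m) (G2 G d b) p * L1b G d a n p)
       - (\<Sum>d\<in>UNIV. torsion d m b p * L1b G d a n p)"
    by (simp only: swap lower_L1[OF p] left_diff_distrib sum_subtractf)
  also have "(\<Sum>c\<in>UNIV. G2 G c b p * (\<Sum>d\<in>UNIV. L1b G c d n p * L1 G d a m p))
     = (\<Sum>d\<in>UNIV. cnj (torsion b n d p) * L1 G d a m p)"
    by (simp only: swap lower_L1b[OF p])
  finally show ?thesis by (simp add: delta_lower_L1b[OF p])
qed

text \<open>
  The covector \<open>\<xi>\<^sub>d = T\<^bsub>d m, b\<^esub> h\<^sup>m cnj (h\<^sup>b)\<close> and the vector obtained by raising its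
  conjugate. The latter is defined through the mixed coefficients of the canonical connection,
  the form in which it appears in \<open>curvature_difference\<close>.
\<close>

definition torsion_form :: "'n \<Rightarrow> 'n point \<Rightarrow> ('n \<Rightarrow> complex) \<Rightarrow> complex" where
  "torsion_form d p h = (\<Sum>m\<in>UNIV. \<Sum>b\<in>UNIV. torsion d m b p * h m * cnj (h b))"

definition torsion_vector :: "'n point \<Rightarrow> ('n \<Rightarrow> complex) \<Rightarrow> 'n \<Rightarrow> complex" where
  "torsion_vector p h d = (\<Sum>a\<in>UNIV. \<Sum>n\<in>UNIV. L1b G d a n p * h a * cnj (h n))"

lemma lower_torsion_vector:
  assumes p: "p \<in> S"
  shows "(\<Sum>d\<in>UNIV. G2 G d e p * torsion_vector p h d) = cnj (torsion_form e p h)"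
proof -
  have "(\<Sum>d\<in>UNIV. G2 G d e p * torsion_vector p h d)
      = (\<Sum>d\<in>UNIV. \<Sum>a\<in>UNIV. \<Sum>n\<in>UNIV. G2 G d e p * L1b G d a n p * (h a * cnj (h n)))"
    by (simp add: torsion_vector_def sum_distrib_left mult_ac)
  also have "\<dots> = (\<Sum>a\<in>UNIV. \<Sum>d\<in>UNIV. \<Sum>n\<in>UNIV. G2 G d e p * L1b G d a n p * (h a * cnj (h n)))"
    by (rule sum.swap)
  also have "\<dots> = (\<Sum>a\<in>UNIV. \<Sum>n\<in>UNIV. \<Sum>d\<in>UNIV. G2 G d e p * L1b G d a n p * (h a * cnj (h n)))"
    by (rule sum.cong[OF refl], rule sum.swap)
  also have "\<dots> = (\<Sum>a\<in>UNIV. \<Sum>n\<in>UNIV. cnj (torsion e n a p) * (h a * cnj (h n)))"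
    by (simp only: sum_distrib_right[symmetric] lower_L1b[OF p])
  also have "\<dots> = (\<Sum>n\<in>UNIV. \<Sum>a\<in>UNIV. cnj (torsion e n a p) * (h a * cnj (h n)))"
    by (rule sum.swap)
  also have "\<dots> = cnj (torsion_form e p h)"
    by (simp add: torsion_form_def mult_ac)
  finally show ?thesis .
qed

text \<open>
  Only the last term of \<open>curvature_difference\<close> survives the contraction. It equals
  \<open>- \<xi>\<^sub>d y\<^sup>d\<close> with \<open>y\<close> the torsion vector, and \<open>\<xi>\<close> is the conjugate of \<open>y\<close> lowered.
\<close>

lemma contracted_curvature_difference:
  assumes p: "p \<in> S"
  shows "contract4 (curv_nabla G) p h - contract4 (curv_D G) p h
    = - (\<Sum>d\<in>UNIV. \<Sum>e\<in>UNIV. G2 G d e p * torsion_vector p h d * cnj (torsion_vector p h e))"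
proof -
  note d = smooth_on_differentiable[OF _ p]
  \<comment> \<open>\<open>A\<close> and \<open>B\<close> are constant in \<open>q\<close>; only their values at \<open>p\<close> enter the contraction at \<open>p\<close>.\<close>
  define A where "A a b m n q = vf_apply (delta G m) (\<lambda>p. cnj (torsion b n a p)) p
      - (\<Sum>d\<in>UNIV. cnj (torsion b n d p) * L1 G d a m p)" for a b m n and q :: "'n point"
  define B where "B a b m n q = (\<Sum>c\<in>UNIV. G2 G c b p * vf_apply (deltab G n) (\<lambda>p. Gam2 G c a m p - L1 G c a m p) p)"
    for a b m n and q :: "'n point"
  define C where "C a b m n q = (\<Sum>d\<in>UNIV. torsion d m b q * L1b G d a n q)" for a b m n q
  have "A a n m b p = - A a b m n p" for a b m n
  proof -
    have 1: "(\<lambda>p. cnj (torsion n b a p)) = (\<lambda>p. - cnj (torsion b n a p))"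
      by (subst torsion_antisymmetric) simp
    have 2: "torsion n b d p = - torsion b n d p" for d
      by (rule torsion_antisymmetric)
    show ?thesis
      unfolding A_def 1 2 vf_apply_minus[OF d[OF smooth_on_cnj[OF open_S smooth_torsion]]]
      by (simp add: sum_negf)
  qed
  then have A: "contract4 A p h = 0" by (rule contract4_antisymmetric_barred)
  have "B m b a n p = - B a b m n p" for a b m n
  proof -
    have L: "L1 G c m a q = L1 G c a m q" for c q by (simp add: L1_def add.commute)
    have L': "L1 G c a m q = (Gam2 G c a m q + Gam2 G c m a q) / 2" for c q
      by (simp add: L1_def Gam2_def distrib_left sum.distrib)
    have "(\<lambda>p. Gam2 G c m a p - L1 G c m a p) = (\<lambda>p. - (Gam2 G c a m p - L1 G c a m p))" for c
      by (simp add: fun_eq_iff L L' field_simps)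
    then show ?thesis
      unfolding B_def
      using vf_apply_minus[OF d[OF smooth_on_diff[OF open_S smooth_Gam2 smooth_L1]]]
      by (simp add: sum_negf)
  qed
  then have B: "contract4 B p h = 0" by (rule contract4_antisymmetric_unbarred)
  have torsion_form: "torsion_form d p h = (\<Sum>e\<in>UNIV. G2 G d e p * cnj (torsion_vector p h e))" for d
  proof -
    have "torsion_form d p h = cnj (\<Sum>e\<in>UNIV. G2 G e d p * torsion_vector p h e)"
      by (simp only: lower_torsion_vector[OF p] complex_cnj_cnj)
    then show ?thesis by (simp add: G2_hermitian[OF p])
  qed
  have "contract4 (curv_nabla G) p h - contract4 (curv_D G) p h
      = contract4 (\<lambda>a b m n q. A a b m n q + B a b m n q - C a b m n q) p h"
    unfolding contract4_diff[symmetric]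
    unfolding contract4_def
    by (simp add: curvature_difference[OF p] A_def B_def C_def)
  also have "\<dots> = - contract4 C p h"
    by (simp add: contract4_diff contract4_add A B)
  also have "contract4 C p h = (\<Sum>d\<in>UNIV. torsion_form d p h * torsion_vector p h d)"
    unfolding C_def torsion_form_def torsion_vector_def by (rule contract4_tensor_product)
  finally show ?thesis by (simp add: torsion_form sum_distrib_left sum_distrib_right mult_ac)
qed

lemma levi_form_eq_0_iff:
  assumes p: "p \<in> S"
  shows "(\<Sum>d\<in>UNIV. \<Sum>e\<in>UNIV. G2 G d e p * y d * cnj (y e)) = 0 \<longleftrightarrow> y = (\<lambda>_. 0)"
proof
  assume 0: "(\<Sum>d\<in>UNIV. \<Sum>e\<in>UNIV. G2 G d e p * y d * cnj (y e)) = 0"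
  have "(\<chi> a. y a) = 0"
    using levi[OF p, unfolded levi_positive_definite_def, rule_format, of "\<chi> a. y a"] 0 by auto
  then show "y = (\<lambda>_. 0)" by (simp add: vec_eq_iff fun_eq_iff)
qed simp

text \<open>
  The difference is minus a squared norm, so it vanishes iff the torsion vector does, and lowering
  an index is injective.
\<close>

lemma contracted_curvatures_eq_iff:
  assumes p: "p \<in> S"
  shows "contract4 (curv_nabla G) p h = contract4 (curv_D G) p h \<longleftrightarrow> (\<forall>d. torsion_form d p h = 0)"
proof -
  have "contract4 (curv_nabla G) p h = contract4 (curv_D G) p h \<longleftrightarrow> torsion_vector p h = (\<lambda>_. 0)"
    using contracted_curvature_difference[OF p, of h] levi_form_eq_0_iff[OF p, of "torsion_vector p h"]
    by auto
  also have "\<dots> \<longleftrightarrow> (\<forall>d. torsion_form d p h = 0)"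
  proof
    assume "torsion_vector p h = (\<lambda>_. 0)"
    then have "cnj (torsion_form d p h) = 0" for d
      using lower_torsion_vector[OF p, of d h] by simp
    then show "\<forall>d. torsion_form d p h = 0" by simp
  next
    assume 0: "\<forall>d. torsion_form d p h = 0"
    have "torsion_vector p h d = 0" for d
      using lower_injective[OF p, of "torsion_vector p h" "\<lambda>_. 0" d]
      by (simp add: lower_torsion_vector[OF p] 0)
    then show "torsion_vector p h = (\<lambda>_. 0)" by auto
  qed
  finally show ?thesis .
qed

subsection \<open>The equivalences in one chart\<close>

lemma torsion_eq_0_iff:
  assumes p: "p \<in> S"
  shows "(\<forall>d m b. torsion d m b p = 0) \<longleftrightarrow> (\<forall>a d m. Gam2 G a d m p = Gam2 G a m d p)"
proof
  assume 0: "\<forall>d m b. torsion d m b p = 0"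
  have "Gam2 G a d m p - Gam2 G a m d p = 0" for a d m
    using lower_injective[OF p, of "\<lambda>a. Gam2 G a d m p - Gam2 G a m d p" "\<lambda>_. 0" a]
    by (simp only: lower_Gam2_antisymmetrized[OF p] 0) simp
  then show "\<forall>a d m. Gam2 G a d m p = Gam2 G a m d p" by simp
next
  assume "\<forall>a d m. Gam2 G a d m p = Gam2 G a m d p"
  then show "\<forall>d m b. torsion d m b p = 0"
    using lower_Gam2_antisymmetrized[OF p] by simp
qed

text \<open>
  The global quantifiers over \<open>S\<close> matter for the direction from left to right, which rests on
  \<open>kaehler_imp_symmetric\<close>.
\<close>

lemma kaehler_iff_torsion_free:
  "(\<forall>p\<in>S. kaehler_at G p) \<longleftrightarrow> (\<forall>p\<in>S. \<forall>d m b. torsion d m b p = 0)"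
proof
  assume "\<forall>p\<in>S. kaehler_at G p"
  then show "\<forall>p\<in>S. \<forall>d m b. torsion d m b p = 0"
    using torsion_eq_0_iff kaehler_imp_symmetric by blast
next
  assume 0: "\<forall>p\<in>S. \<forall>d m b. torsion d m b p = 0"
  show "\<forall>p\<in>S. kaehler_at G p"
    using 0 by (simp add: torsion_eq_0_iff kaehler_at_def)
qed

text \<open>
  The horizontal vectors \<open>H\<close> run through all component vectors \<open>h\<close>, so agreement of the flag
  curvatures says that the sesquilinear forms \<open>torsion_form d p\<close> vanish identically.
\<close>

lemma flag_curv_eq_iff_torsion_free_at:
  assumes p: "p \<in> S"
  shows "(\<forall>H\<in>horizontal_space G p. H \<noteq> (\<lambda>_. 0) \<longrightarrow>
      flag_curv G (curv_nabla G) p H = flag_curv G (curv_D G) p H)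
    \<longleftrightarrow> (\<forall>d m b. torsion d m b p = 0)"
proof
  assume flag: "\<forall>H\<in>horizontal_space G p. H \<noteq> (\<lambda>_. 0) \<longrightarrow>
      flag_curv G (curv_nabla G) p H = flag_curv G (curv_D G) p H"
  have "torsion_form d p h = 0" for d h
  proof (cases "h = (\<lambda>_. 0)")
    case True
    then show ?thesis by (simp add: torsion_form_def)
  next
    case False
    define H where "H k = (\<Sum>m\<in>UNIV. (\<chi> a. h a) $ m * delta G m k p)" for k
    have HZ: "H (Z a) = h a" for a
      by (simp add: H_def delta_def if_distrib[of "\<lambda>x. _ * x"] cong: if_cong)
    have "H \<in> horizontal_space G p"
      unfolding horizontal_space_def H_def[abs_def] by (rule rangeI)
    moreover have "H \<noteq> (\<lambda>_. 0)" using False HZ by (metis ext)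
    ultimately have "flag_curv G (curv_nabla G) p H = flag_curv G (curv_D G) p H"
      using flag by blast
    then have "contract4 (curv_nabla G) p h = contract4 (curv_D G) p h"
      using levi_form_eq_0_iff[OF p, of h] False by (simp add: flag_curv_def HZ)
    then show ?thesis using contracted_curvatures_eq_iff[OF p] by blast
  qed
  then show "\<forall>d m b. torsion d m b p = 0"
    using sesquilinear_form_eq_0[of "\<lambda>m b. torsion _ m b p"] unfolding torsion_form_def by blast
next
  assume "\<forall>d m b. torsion d m b p = 0"
  then have "torsion_form d p h = 0" for d h by (simp add: torsion_form_def)
  then show "\<forall>H\<in>horizontal_space G p. H \<noteq> (\<lambda>_. 0) \<longrightarrow>
      flag_curv G (curv_nabla G) p H = flag_curv G (curv_D G) p H"
    using contracted_curvatures_eq_iff[OF p] by (simp add: flag_curv_def)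
qed

text \<open>
  The hypothesis concerns all of \<open>S\<close> because the first and third term of \<open>curvature_difference\<close>
  contain derivatives of the torsion.
\<close>

lemma curvatures_eq_if_torsion_free:
  assumes T: "\<And>p d m b. p \<in> S \<Longrightarrow> torsion d m b p = 0" and p: "p \<in> S"
  shows "curv_nabla G a b m n p = curv_D G a b m n p"
proof -
  note d = smooth_on_differentiable[OF _ p]
  have "vf_apply (delta G m) (\<lambda>p. cnj (torsion b n a p)) p = vf_apply (delta G m) (\<lambda>p. 0) p"
    by (rule vf_apply_cong[OF open_S p _ d[OF smooth_on_cnj[OF open_S smooth_torsion]]]) (simp add: T)
  moreover have "vf_apply (deltab G n) (\<lambda>p. Gam2 G c a m p - L1 G c a m p) p = vf_apply (deltab G n) (\<lambda>p. 0) p" for c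
  proof (rule vf_apply_cong[OF open_S p _ d[OF smooth_on_diff[OF open_S smooth_Gam2 smooth_L1]]])
    fix q assume q: "q \<in> S"
    have "L1 G c a m q = (Gam2 G c a m q + Gam2 G c m a q) / 2"
      by (simp add: L1_def Gam2_def distrib_left sum.distrib)
    moreover have "Gam2 G c m a q = Gam2 G c a m q"
      using torsion_eq_0_iff[OF q] T[OF q] by blast
    ultimately show "Gam2 G c a m q - L1 G c a m q = 0" by simp
  qed
  ultimately have "curv_nabla G a b m n p - curv_D G a b m n p = 0"
    by (simp add: curvature_difference[OF p] T[OF p])
  then show ?thesis by simp
qed

text \<open>
  At \<open>h = v\<close> the barred slot of the torsion is contracted with the conjugate of \<open>v\<close>, and \<open>euler_G1\<close>
  turns the Levi matrix into \<open>G\<^sub>a\<close>. What remains is the expression of the weak Kaehler condition up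
  to the factor \<open>- 1/2\<close>.
\<close>

lemma hol_sect_curv_eq_iff_weakly_kaehler:
  assumes p: "p \<in> S"
  shows "hol_sect_curv G (curv_nabla G) p = hol_sect_curv G (curv_D G) p \<longleftrightarrow> weakly_kaehler_at G p"
proof -
  have "2 * torsion_form d p (\<lambda>a. snd p $ a)
      = - (\<Sum>a\<in>UNIV. \<Sum>b\<in>UNIV. G1 G a p * (Gam2 G a b d p - Gam2 G a d b p) * snd p $ b)" for d
  proof -
    have "2 * torsion_form d p (\<lambda>a. snd p $ a)
        = (\<Sum>m\<in>UNIV. \<Sum>b\<in>UNIV. 2 * torsion d m b p * (snd p $ m * cnj (snd p $ b)))"
      by (simp add: torsion_form_def sum_distrib_left mult_ac)
    also have "\<dots> = (\<Sum>m\<in>UNIV. \<Sum>b\<in>UNIV. \<Sum>a\<in>UNIV.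
        G2 G a b p * cnj (snd p $ b) * ((Gam2 G a d m p - Gam2 G a m d p) * snd p $ m))"
      unfolding lower_Gam2_antisymmetrized[OF p, symmetric] sum_distrib_right
      by (intro sum.cong refl) (simp only: mult_ac)
    also have "\<dots> = (\<Sum>m\<in>UNIV. \<Sum>a\<in>UNIV. \<Sum>b\<in>UNIV.
        G2 G a b p * cnj (snd p $ b) * ((Gam2 G a d m p - Gam2 G a m d p) * snd p $ m))"
      by (rule sum.cong[OF refl], rule sum.swap)
    also have "\<dots> = (\<Sum>a\<in>UNIV. \<Sum>m\<in>UNIV. \<Sum>b\<in>UNIV.
        G2 G a b p * cnj (snd p $ b) * ((Gam2 G a d m p - Gam2 G a m d p) * snd p $ m))"
      by (rule sum.swap)
    also have "\<dots> = (\<Sum>a\<in>UNIV. \<Sum>m\<in>UNIV. G1 G a p * ((Gam2 G a d m p - Gam2 G a m d p) * snd p $ m))"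
      by (simp only: sum_distrib_right[symmetric] euler_G1[OF p])
    also have "\<dots> = - (\<Sum>a\<in>UNIV. \<Sum>b\<in>UNIV. G1 G a p * (Gam2 G a b d p - Gam2 G a d b p) * snd p $ b)"
      unfolding sum_negf[symmetric] by (intro sum.cong refl) (simp add: algebra_simps)
    finally show ?thesis .
  qed
  then have "(\<Sum>a\<in>UNIV. \<Sum>b\<in>UNIV. G1 G a p * (Gam2 G a b d p - Gam2 G a d b p) * snd p $ b)
      = - (2 * torsion_form d p (\<lambda>a. snd p $ a))" for d
    by simp
  then have "(\<forall>d. torsion_form d p (\<lambda>a. snd p $ a) = 0) \<longleftrightarrow> weakly_kaehler_at G p"
    unfolding weakly_kaehler_at_def by (simp only: neg_equal_0_iff_equal mult_eq_0_iff zero_neq_numeral) simp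
  then show ?thesis
    using contracted_curvatures_eq_iff[OF p] G_nonzero[OF p] by (simp add: hol_sect_curv_def)
qed

end

section \<open>From charts to the manifold\<close>

lemma transition_derivative_complex_linear:
  assumes M: "complex_manifold X A" "c \<in> A" "c' \<in> A" and p: "p \<in> cdom c" "p \<in> cdom c'"
  shows "frechet_derivative (transition c c') (at (crd c p)) (\<zeta> *s v)
       = \<zeta> *s frechet_derivative (transition c c') (at (crd c p)) v"
proof -
  have "holomorphic_map_on (transition c c') (crd c ` (cdom c \<inter> cdom c'))"
    using M unfolding complex_manifold_def by blast
  moreover have "crd c p \<in> crd c ` (cdom c \<inter> cdom c')" using p by blast
  ultimately obtain D where "(transition c c' has_derivative D) (at (crd c p))"
    and "\<And>\<zeta> h. D (\<zeta> *s h) = \<zeta> *s D h"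
    unfolding holomorphic_map_on_def by blast
  then show ?thesis using frechet_derivative_at by metis
qed

text \<open>
  Coordinate changes are holomorphic, so their differentials commute with multiplication by complex
  scalars. This carries the homogeneity of \<open>F\<close> over to its coordinate expressions.
\<close>

lemma tvec_of_scale:
  assumes M: "complex_manifold X A" "c \<in> A" and z: "z \<in> crd c ` cdom c"
  shows "tvec_of A c (z, \<zeta> *s v) = tscale \<zeta> (tvec_of A c (z, v))"
proof -
  obtain p where p: "p \<in> cdom c" "z = crd c p" using z by blast
  have "chart_inv c z = p" using chart_inv_crd[OF M p(1)] p(2) by simp
  then have "(if c' \<in> A \<and> chart_inv c z \<in> cdom c'
        then frechet_derivative (transition c c') (at z) (\<zeta> *s v) else 0)
      = \<zeta> *s (if c' \<in> A \<and> chart_inv c z \<in> cdom c'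
        then frechet_derivative (transition c c') (at z) v else 0)" for c'
    using transition_derivative_complex_linear[OF M _ p(1), of c' \<zeta> v] p(2) by simp
  then show ?thesis by (simp add: tvec_of_def tscale_def)
qed

lemma finsler_metric_imp_finsler_domain:
  assumes M: "complex_manifold X A" and F: "complex_finsler_metric X A F" "strongly_pseudoconvex A F"
    and c: "c \<in> A"
  shows "finsler_domain (Gloc A F c) (slit_coords c)"
proof
  have "open (crd c ` cdom c)" using M c unfolding complex_manifold_def by blast
  then show "open (slit_coords c)"
    unfolding slit_coords_def by (intro open_Times) auto
  show "smooth_on (Gloc A F c) (slit_coords c)"
    using F(1) c unfolding complex_finsler_metric_def by blast
  show "cnj (Gloc A F c p) = Gloc A F c p" for p by (simp add: Gloc_def)
  have w: "tvec_of A c p \<in> slit_tangent_bundle X A" if "p \<in> slit_coords c" for p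
    using bij_betwE[OF slit_coords_bij[OF M c]] that by blast
  have pos: "0 < F (tvec_of A c p)" if "p \<in> slit_coords c" for p
    using F(1) w[OF that] unfolding complex_finsler_metric_def by blast
  show "Gloc A F c p \<noteq> 0" if "p \<in> slit_coords c" for p
    using pos[OF that] by (simp add: Gloc_def)
  show "Gloc A F c (z, \<zeta> *s v) = of_real ((cmod \<zeta>)\<^sup>2) * Gloc A F c (z, v)"
    if "(z, v) \<in> slit_coords c" for z v \<zeta>
  proof -
    have "tvec_of A c (z, v) \<in> tangent_bundle X A"
      using w[OF that] by (simp add: slit_tangent_bundle_def)
    then have "F (tscale \<zeta> (tvec_of A c (z, v))) = cmod \<zeta> * F (tvec_of A c (z, v))"
      using F(1) unfolding complex_finsler_metric_def by blast
    moreover have "z \<in> crd c ` cdom c" using that by (simp add: slit_coords_def)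
    ultimately show ?thesis
      by (simp add: Gloc_def tvec_of_scale[OF M c] power_mult_distrib)
  qed
  show "levi_positive_definite (Gloc A F c) p" if "p \<in> slit_coords c" for p
    using F(2) c that unfolding strongly_pseudoconvex_def by blast
qed

theorem theorem1p1:
  fixes X :: "'m topology"
    and A :: "('m, 'n::finite) chart set"
    and F :: "('m, 'n) tvec \<Rightarrow> real"
  assumes "CARD('n) \<ge> 2"
    and "complex_manifold X A"
    and "complex_finsler_metric X A F"
    and "strongly_pseudoconvex A F"
  shows
    "((\<forall>c\<in>A. \<forall>p\<in>slit_coords c. \<forall>\<alpha> \<beta> \<mu> \<nu>.
         curv_nabla (Gloc A F c) \<alpha> \<beta> \<mu> \<nu> p = curv_D (Gloc A F c) \<alpha> \<beta> \<mu> \<nu> p)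
      \<longleftrightarrow>
      (\<forall>c\<in>A. \<forall>p\<in>slit_coords c. \<forall>H\<in>horizontal_space (Gloc A F c) p. H \<noteq> (\<lambda>_. 0) \<longrightarrow>
         flag_curv (Gloc A F c) (curv_nabla (Gloc A F c)) p H
         = flag_curv (Gloc A F c) (curv_D (Gloc A F c)) p H))
     \<and>
     ((\<forall>c\<in>A. \<forall>p\<in>slit_coords c. \<forall>H\<in>horizontal_space (Gloc A F c) p. H \<noteq> (\<lambda>_. 0) \<longrightarrow>
         flag_curv (Gloc A F c) (curv_nabla (Gloc A F c)) p H
         = flag_curv (Gloc A F c) (curv_D (Gloc A F c)) p H)
      \<longleftrightarrow> kaehler_finsler A F)
     \<and>
     ((\<forall>c\<in>A. \<forall>p\<in>slit_coords c.
         hol_sect_curv (Gloc A F c) (curv_nabla (Gloc A F c)) p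
         = hol_sect_curv (Gloc A F c) (curv_D (Gloc A F c)) p)
      \<longleftrightarrow> weakly_kaehler_finsler A F)"
proof -
  let ?G = "Gloc A F"
  have dom: "finsler_domain (?G c) (slit_coords c)" if "c \<in> A" for c
    using finsler_metric_imp_finsler_domain assms(2-4) that by blast
  let ?torsion_free = "\<lambda>c. \<forall>p\<in>slit_coords c. \<forall>d m b. finsler_domain.torsion (?G c) d m b p = 0"
  let ?equal = "\<lambda>c. \<forall>p\<in>slit_coords c. \<forall>\<alpha> \<beta> \<mu> \<nu>.
    curv_nabla (?G c) \<alpha> \<beta> \<mu> \<nu> p = curv_D (?G c) \<alpha> \<beta> \<mu> \<nu> p"
  let ?flag = "\<lambda>c. \<forall>p\<in>slit_coords c. \<forall>H\<in>horizontal_space (?G c) p. H \<noteq> (\<lambda>_. 0) \<longrightarrow>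
    flag_curv (?G c) (curv_nabla (?G c)) p H = flag_curv (?G c) (curv_D (?G c)) p H"
  have flag: "?flag c \<longleftrightarrow> ?torsion_free c" if "c \<in> A" for c
    using finsler_domain.flag_curv_eq_iff_torsion_free_at[OF dom[OF that]] by (rule ball_cong[OF refl])
  have kaehler: "(\<forall>p\<in>slit_coords c. kaehler_at (?G c) p) \<longleftrightarrow> ?torsion_free c" if "c \<in> A" for c
    by (rule finsler_domain.kaehler_iff_torsion_free[OF dom[OF that]])
  have equal: "?equal c \<longleftrightarrow> ?flag c" if "c \<in> A" for c
  proof
    assume e: "?equal c"
    then have "contract4 (curv_nabla (?G c)) p h = contract4 (curv_D (?G c)) p h"
      if "p \<in> slit_coords c" for p h
      using that by (simp add: contract4_def)
    then show "?flag c" by (simp add: flag_curv_def)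
  next
    assume "?flag c"
    then have "?torsion_free c" using flag[OF that] by blast
    then show "?equal c"
      using finsler_domain.curvatures_eq_if_torsion_free[OF dom[OF that]] by blast
  qed
  have weak: "(\<forall>p\<in>slit_coords c. hol_sect_curv (?G c) (curv_nabla (?G c)) p = hol_sect_curv (?G c) (curv_D (?G c)) p)
      \<longleftrightarrow> (\<forall>p\<in>slit_coords c. weakly_kaehler_at (?G c) p)" if "c \<in> A" for c
    using finsler_domain.hol_sect_curv_eq_iff_weakly_kaehler[OF dom[OF that]] by (rule ball_cong[OF refl])
  show ?thesis
    unfolding kaehler_finsler_def weakly_kaehler_finsler_def
    by (intro conjI; rule ball_cong[OF refl]) (simp_all only: equal flag kaehler weak)
qed

end
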